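(* Let $\lambda$ be regular, let $X, Y \in \mathscr{M}_\lambda$, and suppose that $Y$ is spherically complete. Then for every $\xi < \lambda^+$, \[ \mathcal{B}_\xi(X,Y) = \widehat{\mathcal{B}}_\xi(X,Y) = \mathcal{M}_{\xi+1}(X,Y). \]
   Context: Work in ZFC. $\lambda$ is an uncountable cardinal with $2^{<\lambda}=\lambda$, $\mu=\operatorname{cof}(\lambda)$ (here $\mu=\lambda$ since $\lambda$ is regular). All spaces are regular Hausdorff. $\mathbb{G}$ is a fixed ordered field whose positive part $\mathbb{G}^+$ has coinitiality $\mu$ (the choice is irrelevant). A space is $\mu$-metrizable if its topology is induced by a $\mathbb{G}$-valued metric; $\mathscr{M}_\lambda$ is the class of $\mu$-metrizable spaces of weight $\le\lambda$. $Y$ is spherically complete if it admits a compatible $\mathbb{G}$-metric in which every decreasing sequence of closed balls has nonempty intersection. Borel hierarchy: $\boldsymbol{\Sigma}^0_1(X)$ is the family of open sets; for $1<\xi<\lambda^+$, $\boldsymbol{\Sigma}^0_\xi(X)$ consists of all unions $\bigcup_{i<\lambda}A_i$ where each $X\setminus A_i\in\bigcup_{\xi'<\xi}\boldsymbol{\Sigma}^0_{\xi'}(X)$. $f\colon X\to Y$ is $\boldsymbol{\Sigma}^0_\xi$-measurable if $f^{-1}(U)\in\boldsymbol{\Sigma}^0_\xi(X)$ for all open $U\subseteq Y$; $\mathcal{M}_\xi(X,Y)$ is the set of such functions. Limits: for a directed set $D$, $f=\lim_{d\in D}f_d$ denotes pointwise convergence of the net (for each $x$ and each open $U\ni f(x)$,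 eventually $f_d(x)\in U$). For $1\le\xi<\lambda^+$, $f=\widehat{\lim}{}^\xi_{d\in D} f_d$ means there is a covering $(X_d)_{d\in D}$ of $X$ with $X_d\subseteq X_{d'}$ whenever $d\le d'$, $X_d\in\boldsymbol{\Sigma}^0_\xi(X)$ for all $d$, and $f_{d'}\restriction X_d=f\restriction X_d$ for all $d\le d'$. For a class $\mathcal{F}$ of functions, $D\text{-}\!\lim\mathcal{F}$ is the set of all $\lim_{d\in D}f_d$ with $f_d\in\mathcal{F}$, similarly $\widehat{\lim}{}^\xi_D\mathcal{F}$; for a family $\mathcal{D}$ of directed sets, $\mathcal{D}\text{-}\!\lim\mathcal{F}=\bigcup_{D\in\mathcal{D}}D\text{-}\!\lim\mathcal{F}$ and similarly for $\widehat{\lim}{}^\xi_{\mathcal{D}}$. $\mathrm{Fin}_\lambda$ is the set of finite subsets of $\lambda$ ordered by inclusion; $\mathcal{D}_\lambda$ is the class of directed sets of size $\le\lambda$; ordinals are directed sets with their usual order. $\lambda$-Baire class $\xi$ ($\lambda$ regular): $\mathcal{B}_0(X,Y)$ is the set of continuous functions; if $\xi$ is a successor or a limit with $\operatorname{cof}(\xi)=\lambda$, $\mathcal{B}_\xi(X,Y)=\lambda\text{-}\!\lim\mathcal{B}_{<\xi}(X,Y)$; if $\xi$ is a limit with $\operatorname{cof}(\xi)<\lambda$, $\mathcal{B}_\xi(X,Y)=\mathrm{Fin}_\lambda\text{-}\!\lim\big(\widehat{\lim}{}^\xi_{\operatorname{cof}(\xi)}\mathcal{B}_{<\xi}(X,Y)\big)$,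 where $\mathcal{B}_{<\xi}=\bigcup_{\xi'<\xi}\mathcal{B}_{\xi'}$. Also $\widehat{\mathcal{B}}_0(X,Y)$ is the set of continuous functions and for $\xi>0$, $\widehat{\mathcal{B}}_\xi(X,Y)=\mathcal{D}_\lambda\text{-}\!\lim\big(\widehat{\lim}{}^\xi_{\mathcal{D}_\lambda}\widehat{\mathcal{B}}_{<\xi}(X,Y)\big)$. *)

theory Defs
  imports "HOL-Analysis.Analysis"
begin

unbundle cardinal_syntax
no_notation elt_set_eq (infix \<open>=o\<close> 50)

section \<open>Cardinals and ordinals\<close>

text \<open>
  Throughout, the cardinal \<open>\<lambda>\<close> is a cardinal order \<open>r\<close> (as in the library of cardinals), and the
  ordinals below \<open>\<lambda>\<^sup>+\<close> are the elements of \<^term>\<open>Field (cardSuc r)\<close>; an element \<open>\<xi>\<close> stands for the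
  order type of its set of strict predecessors.
\<close>

text \<open>\<open>2\<^bsup><\<lambda>\<^esup> = \<lambda>\<close>, where \<open>2\<^bsup><\<lambda>\<^esup>\<close> is the supremum of the cardinals \<open>2\<^bsup>\<kappa>\<^esup>\<close> for \<open>\<kappa> < \<lambda>\<close>.
  Cardinals \<open>\<kappa> < \<lambda>\<close>, and potential upper bounds smaller than \<open>\<lambda>\<close>, are all realised on the
  type underlying \<open>\<lambda>\<close>.\<close>

definition two_powers_bounded :: "'l rel \<Rightarrow> 'l rel \<Rightarrow> bool" where
  "two_powers_bounded r s \<longleftrightarrow>
     (\<forall>k :: 'l rel. Card_order k \<and> k <o r \<longrightarrow> ctwo ^c k \<le>o s)"

definition weak_two_power_eq :: "'l rel \<Rightarrow> bool" where
  "weak_two_power_eq r \<longleftrightarrow>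
     two_powers_bounded r r \<and>
     (\<forall>s :: 'l rel. Card_order s \<and> two_powers_bounded r s \<longrightarrow> r \<le>o s)"

text \<open>The library's \<^const>\<open>cofinal\<close> is strict, so this is meant for orders without a
  greatest element. The result is a cardinal, well-ordered in its initial order type.\<close>

definition cofinality :: "'i rel \<Rightarrow> 'i rel" where
  "cofinality s =
     card_of (SOME A. A \<subseteq> Field s \<and> cofinal A s \<and>
                (\<forall>B. B \<subseteq> Field s \<and> cofinal B s \<longrightarrow> |A| \<le>o |B| ))"

definition ozero :: "'i rel \<Rightarrow> 'i" where
  "ozero s = wo_rel.minim s (Field s)"

definition osuc :: "'i rel \<Rightarrow> 'i \<Rightarrow> 'i" where
  "osuc s \<xi> = wo_rel.suc s {\<xi>}"

definition is_osuc :: "'i rel \<Rightarrow> 'i \<Rightarrow> bool" where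
  "is_osuc s \<xi> \<longleftrightarrow> (\<exists>\<eta>\<in>Field s. \<xi> = osuc s \<eta>)"

definition is_olim :: "'i rel \<Rightarrow> 'i \<Rightarrow> bool" where
  "is_olim s \<xi> \<longleftrightarrow> \<xi> \<in> Field s \<and> \<xi> \<noteq> ozero s \<and> \<not> is_osuc s \<xi>"

definition ocof :: "'i rel \<Rightarrow> 'i \<Rightarrow> 'i rel" where
  "ocof s \<xi> = cofinality (Restr s (underS s \<xi>))"


section \<open>Spaces metrized over an ordered field\<close>

definition coinitial_pos :: "'g::linordered_field set \<Rightarrow> bool" where
  "coinitial_pos C \<longleftrightarrow> C \<subseteq> {0<..} \<and> (\<forall>x>0. \<exists>c\<in>C. c \<le> x)"

definition has_coinitiality :: "'g::linordered_field itself \<Rightarrow> 'i rel \<Rightarrow> bool" where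
  "has_coinitiality G k \<longleftrightarrow>
     (\<exists>C :: 'g set. coinitial_pos C \<and> |C| =o k) \<and>
     (\<forall>C :: 'g set. coinitial_pos C \<longrightarrow> k \<le>o |C| )"

definition field_metric :: "'a set \<Rightarrow> ('a \<Rightarrow> 'a \<Rightarrow> 'g::linordered_field) \<Rightarrow> bool" where
  "field_metric S d \<longleftrightarrow>
     (\<forall>x\<in>S. \<forall>y\<in>S. 0 \<le> d x y \<and> (d x y = 0 \<longleftrightarrow> x = y) \<and> d x y = d y x) \<and>
     (\<forall>x\<in>S. \<forall>y\<in>S. \<forall>z\<in>S. d x z \<le> d x y + d y z)"

definition compatible_metric :: "'a topology \<Rightarrow> ('a \<Rightarrow> 'a \<Rightarrow> 'g::linordered_field) \<Rightarrow> bool" where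
  "compatible_metric X d \<longleftrightarrow>
     field_metric (topspace X) d \<and>
     (\<forall>U. openin X U \<longleftrightarrow>
        U \<subseteq> topspace X \<and> (\<forall>x\<in>U. \<exists>e>0. {y \<in> topspace X. d x y < e} \<subseteq> U))"

definition weight_le :: "'a topology \<Rightarrow> 'l rel \<Rightarrow> bool" where
  "weight_le X r \<longleftrightarrow>
     (\<exists>\<B>. |\<B>| \<le>o r \<and> (\<forall>V\<in>\<B>. openin X V) \<and>
        (\<forall>U x. openin X U \<and> x \<in> U \<longrightarrow> (\<exists>V\<in>\<B>. x \<in> V \<and> V \<subseteq> U)))"

text \<open>The class \<open>\<M>\<^sub>\<lambda>\<close>, relative to the ordered field \<open>G\<close>.\<close>

definition metrizable_class ::
    "'g::linordered_field itself \<Rightarrow> 'l rel \<Rightarrow> 'a topology \<Rightarrow> bool" where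
  "metrizable_class G r X \<longleftrightarrow>
     regular_space X \<and> Hausdorff_space X \<and>
     (\<exists>d :: 'a \<Rightarrow> 'a \<Rightarrow> 'g. compatible_metric X d) \<and> weight_le X r"

definition closed_ball :: "'a topology \<Rightarrow> ('a \<Rightarrow> 'a \<Rightarrow> 'g::linordered_field) \<Rightarrow> 'a \<Rightarrow> 'g \<Rightarrow> 'a set" where
  "closed_ball X d x e = {y \<in> topspace X. d x y \<le> e}"

text \<open>Sequences of balls have arbitrary nonzero ordinal length. Since a decreasing sequence of sets
  may be thinned out to a strictly decreasing one with the same intersection, it is enough to
  consider lengths realised by well-orders on \<open>'a set\<close>.\<close>

definition spherically_complete :: "'g::linordered_field itself \<Rightarrow> 'a topology \<Rightarrow> bool" where
  "spherically_complete G X \<longleftrightarrow>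
     (\<exists>d :: 'a \<Rightarrow> 'a \<Rightarrow> 'g. compatible_metric X d \<and>
        (\<forall>(s :: 'a set rel) x e.
           Well_order s \<and> Field s \<noteq> {} \<and>
           (\<forall>i\<in>Field s. x i \<in> topspace X \<and> 0 < e i) \<and>
           (\<forall>(i, j)\<in>s. closed_ball X d (x j) (e j) \<subseteq> closed_ball X d (x i) (e i)) \<longrightarrow>
           (\<Inter>i\<in>Field s. closed_ball X d (x i) (e i)) \<noteq> {}))"


section \<open>Borel hierarchy and measurable functions\<close>

text \<open>The index \<open>1\<close> of the open sets is \<^term>\<open>osuc s (ozero s)\<close> for \<open>s\<close> the successor
  cardinal; the class with index \<open>0\<close> is empty.\<close>

inductive sigma0 :: "'l rel \<Rightarrow> 'a topology \<Rightarrow> 'l set \<Rightarrow> 'a set \<Rightarrow> bool"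
  for r :: "'l rel" and X :: "'a topology" where
  sigma0_one: "openin X U \<Longrightarrow> sigma0 r X (osuc (cardSuc r) (ozero (cardSuc r))) U"
| sigma0_step: "sigma0 r X \<xi> (\<Union>i\<in>Field r. A i)"
    if "\<xi> \<in> Field (cardSuc r)"
      "osuc (cardSuc r) (ozero (cardSuc r)) \<in> underS (cardSuc r) \<xi>"
      "\<And>i. i \<in> Field r \<Longrightarrow>
         A i \<subseteq> topspace X \<and> (\<exists>\<xi>'\<in>underS (cardSuc r) \<xi>. sigma0 r X \<xi>' (topspace X - A i))"

text \<open>Functions between spaces are represented by their extensional representatives.\<close>

definition measurable_fun ::
    "'l rel \<Rightarrow> 'a topology \<Rightarrow> 'b topology \<Rightarrow> 'l set \<Rightarrow> ('a \<Rightarrow> 'b) set" where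
  "measurable_fun r X Y \<xi> =
     {f \<in> topspace X \<rightarrow>\<^sub>E topspace Y.
        \<forall>U. openin Y U \<longrightarrow> sigma0 r X \<xi> {x \<in> topspace X. f x \<in> U}}"


section \<open>Limits along directed sets\<close>

text \<open>A directed set is a relation \<open>D\<close> whose field is the carrier.\<close>

definition directed_rel :: "'d rel \<Rightarrow> bool" where
  "directed_rel D \<longleftrightarrow>
     Preorder D \<and> Field D \<noteq> {} \<and>
     (\<forall>a\<in>Field D. \<forall>b\<in>Field D. \<exists>c\<in>Field D. (a, c) \<in> D \<and> (b, c) \<in> D)"

definition fin_dir :: "'l rel \<Rightarrow> 'l set rel" where
  "fin_dir r = {(F, F'). F \<subseteq> F' \<and> finite F' \<and> F' \<subseteq> Field r}"

text \<open>The directed sets of size at most \<open>\<lambda>\<close>, up to isomorphism.\<close>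

definition small_directed :: "'l rel \<Rightarrow> 'l rel set" where
  "small_directed r = {D. directed_rel D \<and> |Field D| \<le>o r}"

definition net_lim ::
    "'d rel \<Rightarrow> 'a topology \<Rightarrow> 'b topology \<Rightarrow> ('a \<Rightarrow> 'b) set \<Rightarrow> ('a \<Rightarrow> 'b) set" where
  "net_lim D X Y \<F> =
     {f \<in> topspace X \<rightarrow>\<^sub>E topspace Y.
        \<exists>g. (\<forall>d\<in>Field D. g d \<in> \<F>) \<and>
            (\<forall>x\<in>topspace X. \<forall>U. openin Y U \<and> f x \<in> U \<longrightarrow>
               (\<exists>d0\<in>Field D. \<forall>d. (d0, d) \<in> D \<longrightarrow> g d x \<in> U))}"

definition hat_lim ::
    "'l rel \<Rightarrow> 'l set \<Rightarrow> 'd rel \<Rightarrow> 'a topology \<Rightarrow> 'b topology \<Rightarrow> ('a \<Rightarrow> 'b) set \<Rightarrow> ('a \<Rightarrow> 'b) set" where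
  "hat_lim r \<xi> D X Y \<F> =
     {f \<in> topspace X \<rightarrow>\<^sub>E topspace Y.
        \<exists>g C. (\<forall>d\<in>Field D. g d \<in> \<F>) \<and>
            (\<Union>d\<in>Field D. C d) = topspace X \<and>
            (\<forall>d\<in>Field D. sigma0 r X \<xi> (C d)) \<and>
            (\<forall>(d, d')\<in>D. C d \<subseteq> C d') \<and>
            (\<forall>(d, d')\<in>D. \<forall>x\<in>C d. g d' x = f x)}"


section \<open>Baire classes\<close>

definition continuous_fun :: "'a topology \<Rightarrow> 'b topology \<Rightarrow> ('a \<Rightarrow> 'b) set" where
  "continuous_fun X Y = {f \<in> topspace X \<rightarrow>\<^sub>E topspace Y. continuous_map X Y f}"

text \<open>Both hierarchies are defined by well-founded recursion along \<^term>\<open>cardSuc r\<close>; the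
  recursive equations are the lemmas at the end.\<close>

definition Baire_step ::
    "'l rel \<Rightarrow> 'a topology \<Rightarrow> 'b topology \<Rightarrow> ('l set \<Rightarrow> ('a \<Rightarrow> 'b) set) \<Rightarrow> 'l set \<Rightarrow> ('a \<Rightarrow> 'b) set" where
  "Baire_step r X Y B \<xi> =
     (let s = cardSuc r; \<F> = (\<Union>\<xi>'\<in>underS s \<xi>. B \<xi>') in
      if \<xi> = ozero s then continuous_fun X Y
      else if is_osuc s \<xi> \<or> is_olim s \<xi> \<and> ocof s \<xi> =o r then net_lim r X Y \<F>
      else if is_olim s \<xi> \<and> ocof s \<xi> <o r
        then net_lim (fin_dir r) X Y (hat_lim r \<xi> (ocof s \<xi>) X Y \<F>)
      else {})"

definition Baire :: "'l rel \<Rightarrow> 'a topology \<Rightarrow> 'b topology \<Rightarrow> 'l set \<Rightarrow> ('a \<Rightarrow> 'b) set" where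
  "Baire r X Y = wo_rel.worec (cardSuc r) (Baire_step r X Y)"

definition Baire_hat_step ::
    "'l rel \<Rightarrow> 'a topology \<Rightarrow> 'b topology \<Rightarrow> ('l set \<Rightarrow> ('a \<Rightarrow> 'b) set) \<Rightarrow> 'l set \<Rightarrow> ('a \<Rightarrow> 'b) set" where
  "Baire_hat_step r X Y B \<xi> =
     (let s = cardSuc r; \<F> = (\<Union>\<xi>'\<in>underS s \<xi>. B \<xi>') in
      if \<xi> = ozero s then continuous_fun X Y
      else \<Union>D\<in>small_directed r. net_lim D X Y (\<Union>E\<in>small_directed r. hat_lim r \<xi> E X Y \<F>))"

definition Baire_hat :: "'l rel \<Rightarrow> 'a topology \<Rightarrow> 'b topology \<Rightarrow> 'l set \<Rightarrow> ('a \<Rightarrow> 'b) set" where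
  "Baire_hat r X Y = wo_rel.worec (cardSuc r) (Baire_hat_step r X Y)"

lemma wo_rel_cardSuc: "Card_order r \<Longrightarrow> wo_rel (cardSuc r)"
  using cardSuc_Card_order unfolding wo_rel_def card_order_on_def by blast

lemma Baire_unfold:
  assumes "Card_order r"
  shows "Baire r X Y \<xi> = Baire_step r X Y (Baire r X Y) \<xi>"
proof -
  have "Baire_step r X Y B \<xi> = Baire_step r X Y B' \<xi>"
    if "\<forall>y\<in>underS (cardSuc r) \<xi>. B y = B' y" for B B' \<xi>
  proof -
    have "(\<Union>\<xi>'\<in>underS (cardSuc r) \<xi>. B \<xi>') = (\<Union>\<xi>'\<in>underS (cardSuc r) \<xi>. B' \<xi>')"
      using that by simp
    then show ?thesis by (simp only: Baire_step_def Let_def)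
  qed
  then have "wo_rel.adm_wo (cardSuc r) (Baire_step r X Y)"
    unfolding wo_rel.adm_wo_def[OF wo_rel_cardSuc[OF assms]] by blast
  from wo_rel.worec_fixpoint[OF wo_rel_cardSuc[OF assms] this] show ?thesis
    unfolding Baire_def by (rule fun_cong)
qed

lemma Baire_hat_unfold:
  assumes "Card_order r"
  shows "Baire_hat r X Y \<xi> = Baire_hat_step r X Y (Baire_hat r X Y) \<xi>"
proof -
  have "Baire_hat_step r X Y B \<xi> = Baire_hat_step r X Y B' \<xi>"
    if "\<forall>y\<in>underS (cardSuc r) \<xi>. B y = B' y" for B B' \<xi>
  proof -
    have "(\<Union>\<xi>'\<in>underS (cardSuc r) \<xi>. B \<xi>') = (\<Union>\<xi>'\<in>underS (cardSuc r) \<xi>. B' \<xi>')"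
      using that by simp
    then show ?thesis by (simp only: Baire_hat_step_def Let_def)
  qed
  then have "wo_rel.adm_wo (cardSuc r) (Baire_hat_step r X Y)"
    unfolding wo_rel.adm_wo_def[OF wo_rel_cardSuc[OF assms]] by blast
  from wo_rel.worec_fixpoint[OF wo_rel_cardSuc[OF assms] this] show ?thesis
    unfolding Baire_hat_def by (rule fun_cong)
qed

lemma osuc_cardSuc:
  assumes "Card_order r" "infinite (Field r)" "\<eta> \<in> Field (cardSuc r)"
  shows "osuc (cardSuc r) \<eta> \<in> Field (cardSuc r)"
    and "\<eta> \<in> underS (cardSuc r) (osuc (cardSuc r) \<eta>)"
    and "osuc (cardSuc r) \<eta> \<noteq> ozero (cardSuc r)"
proof -
  let ?s = "cardSuc r"
  have co: "Card_order ?s" using assms(1) by (rule cardSuc_Card_order)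
  note wo = wo_rel_cardSuc[OF assms(1)]
  have inf: "infinite (Field ?s)" using cardSuc_finite[OF assms(1)] assms(2) by blast
  obtain b where b: "b \<in> Field ?s" "\<eta> \<noteq> b" "(\<eta>, b) \<in> ?s"
    using infinite_Card_order_limit[OF co inf assms(3)] by blast
  then have ne: "AboveS ?s {\<eta>} \<noteq> {}" unfolding AboveS_def by blast
  have *: "osuc ?s \<eta> \<in> AboveS ?s {\<eta>}"
    unfolding osuc_def using wo_rel.suc_AboveS[OF wo _ ne] assms(3) by blast
  then show "osuc ?s \<eta> \<in> Field ?s" and 2: "\<eta> \<in> underS ?s (osuc ?s \<eta>)"
    unfolding AboveS_def underS_def by blast+
  have 3: "(ozero ?s, \<eta>) \<in> ?s"
    unfolding ozero_def using wo_rel.minim_least[OF wo subset_refl assms(3)] .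
  show "osuc ?s \<eta> \<noteq> ozero ?s"
  proof
    assume "osuc ?s \<eta> = ozero ?s"
    with 2 have "(\<eta>, ozero ?s) \<in> ?s" "\<eta> \<noteq> ozero ?s" unfolding underS_def by simp_all
    with 3 show False using antisymD[OF wo_rel.ANTISYM[OF wo]] by metis
  qed
qed

lemma Baire_ozero:
  assumes "Card_order r"
  shows "Baire r X Y (ozero (cardSuc r)) = continuous_fun X Y"
  by (subst Baire_unfold[OF assms]) (simp only: Baire_step_def Let_def simp_thms if_True)

lemma Baire_lambda:
  assumes "Card_order r" "infinite (Field r)"
    and "is_osuc (cardSuc r) \<xi> \<or> is_olim (cardSuc r) \<xi> \<and> ocof (cardSuc r) \<xi> =o r"
  shows "Baire r X Y \<xi> = net_lim r X Y (\<Union>\<xi>'\<in>underS (cardSuc r) \<xi>. Baire r X Y \<xi>')"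
proof -
  have nz: "\<xi> \<noteq> ozero (cardSuc r)"
    using osuc_cardSuc(3)[OF assms(1,2)] assms(3) unfolding is_osuc_def is_olim_def by metis
  show ?thesis
    by (subst Baire_unfold[OF assms(1)])
      (simp only: Baire_step_def Let_def nz assms(3) if_True if_False)
qed

lemma Baire_small_cof:
  assumes "Card_order r" "is_olim (cardSuc r) \<xi>" "ocof (cardSuc r) \<xi> <o r"
  shows "Baire r X Y \<xi> =
    net_lim (fin_dir r) X Y
      (hat_lim r \<xi> (ocof (cardSuc r) \<xi>) X Y
        (\<Union>\<xi>'\<in>underS (cardSuc r) \<xi>. Baire r X Y \<xi>'))"
proof -
  have nz: "\<xi> \<noteq> ozero (cardSuc r)" "\<not> is_osuc (cardSuc r) \<xi>"
    using assms(2) unfolding is_olim_def by blast+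
  have nl: "\<not> ocof (cardSuc r) \<xi> =o r"
    using assms(3) not_ordLess_ordIso by blast
  show ?thesis
    by (subst Baire_unfold[OF assms(1)])
      (simp only: Baire_step_def Let_def nz nl assms(2,3) if_True if_False simp_thms)
qed

lemma Baire_hat_ozero:
  assumes "Card_order r"
  shows "Baire_hat r X Y (ozero (cardSuc r)) = continuous_fun X Y"
  by (subst Baire_hat_unfold[OF assms]) (simp only: Baire_hat_step_def Let_def simp_thms if_True)

lemma Baire_hat_pos:
  assumes "Card_order r" "\<xi> \<noteq> ozero (cardSuc r)"
  shows "Baire_hat r X Y \<xi> =
    (\<Union>D\<in>small_directed r. net_lim D X Y
      (\<Union>E\<in>small_directed r. hat_lim r \<xi> E X Y
        (\<Union>\<xi>'\<in>underS (cardSuc r) \<xi>. Baire_hat r X Y \<xi>')))"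
  by (subst Baire_hat_unfold[OF assms(1)])
    (simp only: Baire_hat_step_def Let_def assms(2) if_False)

end

(* For an uncountable regular cardinal a field-valued metric yields a decreasing family, indexed by
   the cardinal, of equivalence relations with open classes, and spherical completeness says that
   nested classes have a common point.

   Limits of measurable functions are handled by counting quantifiers. Conversely, let f have index
   xi + 1. For every a the space X is covered by Pi_xi sets P a k on which f stays in one class of
   the a-th relation. If families of fewer than lambda ordinals below xi are bounded below xi, each P a k
   is an intersection of lambda many Delta sets below the level xi + 1, and the gamma-th
   approximation of f uses the first gamma of these sets to guess the least k with x in P a k for
   each a < gamma. If xi is a limit of small cofinality, one can only treat finitely many P a k at a
   time, and a finite system of constraints "g maps P a k into its class" is solved by a function
   that is eventually constant along cof(xi). *)
theory Submission
  imports Defs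
begin

text \<open>The levels of the approximants decide the construction. By induction the functions of
  class below \<xi> are those of some index \<eta>+1 with \<eta> < \<xi>, and successor levels are
  closed under intersections of fewer than \<lambda> sets because 2^(<\<lambda>) = \<lambda>. So an
  approximation that consults fewer than \<lambda> sets is admissible as soon as their levels have a
  bound below \<xi>. Guesses made from incomplete information may contradict each other; spherical
  completeness supplies a value for their coherent part. If cof(\<xi>) < \<lambda>, the levels
  consulted may be unbounded in \<xi>. The inner limit then reveals them gradually, but it has to be
  attained exactly at some stage for every point. The value f(x) satisfies all constraints that
  apply to x, and finitely many others are refuted by a common stage in any well-order, whatever its
  cofinality: hence finite systems. In the other direction classes are clopen, so the limit lies in
  a class if and only if the approximants eventually do, which costs one "exists, for all" over at
  most \<lambda> indices and hence one level.\<close>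

section \<open>Cardinal arithmetic at a regular \<lambda>\<close>

locale regular_cardinal =
  fixes r :: "'l rel"
  assumes card: "Card_order r"
    and uncountable: "natLeq <o r"
    and regular: "regularCard r"
    and two_powers: "two_powers_bounded r r"
begin

lemma infinite_Field: "infinite (Field r)"
proof -
  have "natLeq \<le>o |Field r|"
    by (rule ordLeq_ordIso_trans[OF ordLess_imp_ordLeq[OF uncountable]
          ordIso_symmetric[OF card_of_Field_ordIso[OF card]]])
  then show ?thesis using infinite_iff_natLeq_ordLeq by blast
qed

lemma stable: "stable r"
  by (rule regularCard_stable[OF card infinite_Field regular])

lemma wo: "wo_rel r"
  using card unfolding wo_rel_def card_order_on_def by blast

lemma finite_small: "finite A \<Longrightarrow> |A| <o r"
  using infinite_Field finite_ordLess_infinite[OF card_of_Well_order, of r A] wo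
  unfolding wo_rel_def by (simp add: Field_card_of)

lemma countable_small: "countable A \<Longrightarrow> |A| <o r"
proof -
  assume "countable A"
  then have "|A| \<le>o |UNIV :: nat set|"
    unfolding countable_def card_of_ordLeq[symmetric] by blast
  then show ?thesis
    by (rule ordLeq_ordLess_trans[OF ordLeq_ordIso_trans[OF _ card_of_nat] uncountable])
qed

lemma image_small: "|A| <o r \<Longrightarrow> |f ` A| <o r"
  by (rule ordLeq_ordLess_trans[OF card_of_image])

lemma subset_small: "|A| <o r \<Longrightarrow> B \<subseteq> A \<Longrightarrow> |B| <o r"
  by (rule ordLeq_ordLess_trans[OF card_of_mono1])

lemma Un_small: "|A| <o r \<Longrightarrow> |B| <o r \<Longrightarrow> |A \<union> B| <o r"
  by (rule card_of_Un_ordLess_infinite_Field[OF infinite_Field card])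

lemma insert_small: "|A| <o r \<Longrightarrow> |insert a A| <o r"
  using Un_small[OF finite_small[of "{a}"], of A] by simp

lemma Sigma_small: "|A| <o r \<Longrightarrow> (\<And>a. a \<in> A \<Longrightarrow> |B a| <o r) \<Longrightarrow> |Sigma A B| <o r"
  using stable_elim[OF stable, of A B] by blast

lemma underS_small: "|underS r a| <o r"
proof (cases "a \<in> Field r")
  case True
  then show ?thesis by (rule card_of_underS[OF card])
next
  case False
  then have "underS r a = {}" unfolding underS_def Field_def by auto
  then show ?thesis by (simp add: finite_small)
qed

lemma under_small: "|under r a| <o r"
proof -
  have "under r a \<subseteq> insert a (underS r a)" unfolding under_def underS_def by auto
  then show ?thesis using insert_small[OF underS_small] subset_small by blast
qed

lemma small_imp_le: "|A| <o r \<Longrightarrow> |A| \<le>o r"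
  by (rule ordLess_imp_ordLeq)

lemma finite_le: "finite A \<Longrightarrow> |A| \<le>o r"
  by (rule small_imp_le[OF finite_small])

lemma Field_le: "|Field r| \<le>o r"
  by (rule ordIso_imp_ordLeq[OF card_of_Field_ordIso[OF card]])

lemma image_le: "|A| \<le>o r \<Longrightarrow> |f ` A| \<le>o r"
  by (rule ordLeq_transitive[OF card_of_image])

lemma subset_le: "|A| \<le>o r \<Longrightarrow> B \<subseteq> A \<Longrightarrow> |B| \<le>o r"
  by (rule ordLeq_transitive[OF card_of_mono1])

lemma Sigma_le: "|A| \<le>o r \<Longrightarrow> (\<And>a. a \<in> A \<Longrightarrow> |B a| \<le>o r) \<Longrightarrow> |Sigma A B| \<le>o r"
  using card_of_Sigma_ordLeq_infinite_Field[OF infinite_Field card] by blast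

lemma UN_le: "|A| \<le>o r \<Longrightarrow> (\<And>a. a \<in> A \<Longrightarrow> |B a| \<le>o r) \<Longrightarrow> |\<Union>a\<in>A. B a| \<le>o r"
  by (rule ordLeq_transitive[OF card_of_UNION_Sigma Sigma_le])

lemma obtain_enum:
  assumes "|A| \<le>o r" "A \<noteq> {}"
  obtains f where "f ` Field r = A"
proof -
  have "|A| \<le>o |Field r|"
    by (rule ordLeq_ordIso_trans[OF assms(1) ordIso_symmetric[OF card_of_Field_ordIso[OF card]]])
  with assms(2) obtain f where "f ` Field r = A" using card_of_ordLeq2[of A "Field r"] by blast
  then show ?thesis using that by blast
qed

text \<open>\<open>two_powers\<close> speaks only of cardinals on the type of \<open>r\<close>, so
  \<open>K\<close> is first copied into \<open>Field r\<close>. All counting of choices and of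
  answer patterns goes through this lemma.\<close>

lemma Pow_small_le:
  assumes "|K| <o r"
  shows "|Pow K| \<le>o r"
proof -
  have "|K| \<le>o |Field r|"
    by (rule ordLeq_ordIso_trans[OF ordLess_imp_ordLeq[OF assms]
          ordIso_symmetric[OF card_of_Field_ordIso[OF card]]])
  then obtain f where f: "inj_on f K" "f ` K \<subseteq> Field r"
    using card_of_ordLeq[of K "Field r"] by blast
  let ?k = "|f ` K|"
  have "?k =o |K|"
    by (rule ordIso_symmetric[OF card_of_ordIsoI[OF inj_on_imp_bij_betw[OF f(1)]]])
  then have "?k <o r" by (rule ordIso_ordLess_trans[OF _ assms])
  then have le: "ctwo ^c ?k \<le>o r"
    using two_powers card_of_Card_order unfolding two_powers_bounded_def by blast
  have "|Pow K| =o ctwo ^c |K|"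
    using card_of_Pow_Func[of K] unfolding cexp_def ctwo_def by (simp add: Field_card_of)
  also have "ctwo ^c |K| =o ctwo ^c ?k"
    by (rule cexp_cong2[OF ordIso_symmetric[OF \<open>?k =o |K|\<close>] Card_order_ctwo card_of_Card_order])
  finally show ?thesis by (rule ordIso_ordLeq_trans[OF _ le])
qed

text \<open>By regularity \<open>H\<close> is not cofinal, which gives a weak bound
  \<open>a\<close>; \<lambda> has no greatest element, so some \<open>c\<close> above
  \<open>a\<close> is a strict bound. Strictness is wanted because stage \<gamma> of an
  approximation consults only indices below \<gamma>.\<close>

lemma small_strictly_bounded:
  assumes "H \<subseteq> Field r" "|H| <o r"
  obtains b where "b \<in> Field r" "H \<subseteq> underS r b"
proof -
  have "\<not> cofinal H r"
    using assms regular not_ordLess_ordIso unfolding regularCard_def by blast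
  then obtain a where a: "a \<in> Field r" "\<forall>b\<in>H. \<not> (a \<noteq> b \<and> (a, b) \<in> r)"
    unfolding cofinal_def by blast
  obtain c where c: "c \<in> Field r" "a \<noteq> c" "(a, c) \<in> r"
    using infinite_Card_order_limit[OF card infinite_Field a(1)] by blast
  have "H \<subseteq> underS r c"
  proof
    fix h assume h: "h \<in> H"
    then have "(h, a) \<in> r"
      using a(1) bspec[OF a(2) h] subsetD[OF assms(1) h] wo_rel.TOTALS[OF wo] by blast
    then have "(h, c) \<in> r" using c wo_rel.TRANS[OF wo] unfolding trans_def by blast
    moreover have "h \<noteq> c" using a(2) c h by blast
    ultimately show "h \<in> underS r c" unfolding underS_def by blast
  qed
  then show ?thesis using that c by blast
qed

text \<open>The coinitiality of the field is given as \<open>cofinality r\<close>, a value defined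
  by choice. Regularity gives every cofinal set the size \<lambda>, so the choice does not
  matter.\<close>

lemma cofinality_ordIso: "cofinality r =o r"
proof -
  define Q where "Q A \<longleftrightarrow> A \<subseteq> Field r \<and> cofinal A r \<and> (\<forall>B. B \<subseteq> Field r \<and> cofinal B r \<longrightarrow> |A| \<le>o |B| )" for A
  have "cofinal (Field r) r"
    unfolding cofinal_def using infinite_Card_order_limit[OF card infinite_Field] by blast
  moreover have "|Field r| \<le>o |B|" if "B \<subseteq> Field r" "cofinal B r" for B
    using that regular ordLeq_ordIso_trans[OF Field_le ordIso_symmetric, of "|B|"]
    unfolding regularCard_def by blast
  ultimately have "Q (Field r)" unfolding Q_def by blast
  then have "Q (SOME A. Q A)" by (rule someI)
  then show ?thesis using regular unfolding cofinality_def regularCard_def Q_def by blast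
qed

end

section \<open>Ordinals and the Borel hierarchy over nested equivalence relations\<close>

context regular_cardinal
begin

abbreviation s :: "'l set rel" where "s \<equiv> cardSuc r"

abbreviation ole :: "'l set \<Rightarrow> 'l set \<Rightarrow> bool" (infix \<open>\<unlhd>\<close> 50) where "a \<unlhd> b \<equiv> (a, b) \<in> s"

abbreviation oless :: "'l set \<Rightarrow> 'l set \<Rightarrow> bool" (infix \<open>\<lhd>\<close> 50) where "a \<lhd> b \<equiv> a \<in> underS s b"

abbreviation one :: "'l set" where "one \<equiv> osuc s (ozero s)"

lemma wo_s: "wo_rel s"
  by (rule wo_rel_cardSuc[OF card])

lemma ole_Field: "a \<unlhd> b \<Longrightarrow> a \<in> Field s" "a \<unlhd> b \<Longrightarrow> b \<in> Field s"
  unfolding Field_def by blast+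

lemma oless_imp_ole: "a \<lhd> b \<Longrightarrow> a \<unlhd> b"
  unfolding underS_def by blast

lemma oless_Field: "a \<lhd> b \<Longrightarrow> a \<in> Field s" "a \<lhd> b \<Longrightarrow> b \<in> Field s"
  using oless_imp_ole ole_Field by blast+

lemma ole_refl: "a \<in> Field s \<Longrightarrow> a \<unlhd> a"
  using wo_rel.REFL[OF wo_s] unfolding refl_on_def by blast

lemma ole_trans: "a \<unlhd> b \<Longrightarrow> b \<unlhd> c \<Longrightarrow> a \<unlhd> c"
  using wo_rel.TRANS[OF wo_s] unfolding trans_def by blast

lemma ole_antisym: "a \<unlhd> b \<Longrightarrow> b \<unlhd> a \<Longrightarrow> a = b"
  using wo_rel.ANTISYM[OF wo_s] unfolding antisym_def by blast

lemma oless_irrefl: "\<not> a \<lhd> a"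
  unfolding underS_def by blast

lemma oless_ole_trans: "a \<lhd> b \<Longrightarrow> b \<unlhd> c \<Longrightarrow> a \<lhd> c"
  using ole_trans ole_antisym unfolding underS_def by blast

lemma ole_oless_trans: "a \<unlhd> b \<Longrightarrow> b \<lhd> c \<Longrightarrow> a \<lhd> c"
  using ole_trans ole_antisym unfolding underS_def by blast

lemma ole_or_oless: "a \<in> Field s \<Longrightarrow> b \<in> Field s \<Longrightarrow> a \<unlhd> b \<or> b \<lhd> a"
  using wo_rel.TOTALS[OF wo_s] ole_refl unfolding underS_def by blast

lemma ole_iff_oless_or_eq: "a \<unlhd> b \<longleftrightarrow> a \<lhd> b \<or> (a = b \<and> a \<in> Field s)"
  using ole_refl ole_Field unfolding underS_def by blast

lemma osuc_Field: "a \<in> Field s \<Longrightarrow> osuc s a \<in> Field s"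
  and oless_osuc: "a \<in> Field s \<Longrightarrow> a \<lhd> osuc s a"
  and osuc_neq_ozero: "a \<in> Field s \<Longrightarrow> osuc s a \<noteq> ozero s"
  using osuc_cardSuc[OF card infinite_Field] by blast+

lemma osuc_least: "a \<lhd> b \<Longrightarrow> osuc s a \<unlhd> b"
  unfolding osuc_def
  by (rule wo_rel.suc_least_AboveS[OF wo_s]) (auto simp: AboveS_def underS_def Field_def)

lemma oless_osuc_iff: "b \<in> Field s \<Longrightarrow> a \<lhd> osuc s b \<longleftrightarrow> a \<unlhd> b"
  using osuc_least ole_or_oless oless_Field oless_osuc ole_oless_trans oless_irrefl oless_ole_trans
  by metis

lemma osuc_mono: "a \<unlhd> b \<Longrightarrow> osuc s a \<unlhd> osuc s b"
  using osuc_least ole_oless_trans oless_osuc ole_Field by blast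

lemma ozero_Field: "ozero s \<in> Field s"
  unfolding ozero_def
  using wo_rel.minim_inField[OF wo_s, of "Field s"] Field_cardSuc_not_empty[OF card] by blast

lemma ozero_le: "a \<in> Field s \<Longrightarrow> ozero s \<unlhd> a"
  unfolding ozero_def using wo_rel.minim_least[OF wo_s] by blast

lemma one_Field: "one \<in> Field s"
  by (rule osuc_Field[OF ozero_Field])

lemma one_le: "a \<in> Field s \<Longrightarrow> a \<noteq> ozero s \<Longrightarrow> one \<unlhd> a"
  using osuc_least ozero_le ole_iff_oless_or_eq by metis

lemma one_le_osuc: "a \<in> Field s \<Longrightarrow> one \<unlhd> osuc s a"
  using osuc_mono ozero_le by blast

lemma oless_induct [consumes 1, case_names less]:
  assumes "a \<in> Field s" and "\<And>a. a \<in> Field s \<Longrightarrow> (\<And>b. b \<lhd> a \<Longrightarrow> P b) \<Longrightarrow> P a"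
  shows "P a"
proof -
  have "a \<in> Field s \<longrightarrow> P a"
  proof (induction a rule: wo_rel.well_order_induct[OF wo_s])
    case (1 a)
    show ?case
    proof
      assume "a \<in> Field s"
      then show "P a"
      proof (rule assms(2))
        fix b assume b: "b \<lhd> a"
        then have "b \<noteq> a \<and> b \<unlhd> a" unfolding underS_def by blast
        then show "P b" using 1 oless_Field(1)[OF b] by blast
      qed
    qed
  qed
  then show ?thesis using assms(1) by (rule mp)
qed

lemma osuc_oless_olim:
  assumes "is_olim s a" "b \<lhd> a"
  shows "osuc s b \<lhd> a"
  using assms osuc_least[OF assms(2)] oless_Field(1)[OF assms(2)] ole_iff_oless_or_eq
  unfolding is_olim_def is_osuc_def by blast

text \<open>This bounds the cofinality of every limit index by \<lambda>, so the two limit cases in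
  the recursion for Baire classes are exhaustive.\<close>

lemma card_underS_le: "|underS s a| \<le>o r"
proof (cases "a \<in> Field s")
  case True
  have "|underS s a| <o s" by (rule card_of_underS[OF cardSuc_Card_order[OF card] True])
  then show ?thesis
    using cardSuc_ordLeq_ordLess[OF card card_of_Card_order] by blast
next
  case False
  then have "underS s a = {}" unfolding underS_def Field_def by auto
  then show ?thesis using finite_le[of "underS s a"] by simp
qed

end

section \<open>Borel classes over nested equivalence relations\<close>

text \<open>All that is kept of a metric: larger indices give finer relations, and the classes form
  a base. The triangle inequality has become transitivity, which makes the space
  zero-dimensional.\<close>

locale nested_space = regular_cardinal r for r :: "'l rel" +
  fixes X :: "'a topology" and E :: "'l \<Rightarrow> 'a \<Rightarrow> 'a \<Rightarrow> bool"
  assumes E_in: "\<And>a x y. E a x y \<Longrightarrow> x \<in> topspace X \<and> y \<in> topspace X"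
    and E_refl: "\<And>a x. x \<in> topspace X \<Longrightarrow> E a x x"
    and E_sym: "\<And>a x y. E a x y \<Longrightarrow> E a y x"
    and E_trans: "\<And>a x y z. E a x y \<Longrightarrow> E a y z \<Longrightarrow> E a x z"
    and E_mono: "\<And>a b x y. (a, b) \<in> r \<Longrightarrow> E b x y \<Longrightarrow> E a x y"
    and open_iff: "\<And>U. openin X U \<longleftrightarrow>
      U \<subseteq> topspace X \<and> (\<forall>x\<in>U. \<exists>a\<in>Field r. \<forall>y. E a x y \<longrightarrow> y \<in> U)"
begin

text \<open>By symmetry the complement of a saturated set is saturated, so saturation under a single
  relation already gives a clopen set.\<close>

lemma open_saturated:
  assumes "a \<in> Field r" "U \<subseteq> topspace X" "\<And>x y. x \<in> U \<Longrightarrow> E a x y \<Longrightarrow> y \<in> U"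
  shows "openin X U" "openin X (topspace X - U)"
proof -
  show "openin X U" unfolding open_iff using assms by blast
  show "openin X (topspace X - U)"
    unfolding open_iff using assms E_sym E_in by blast
qed

lemma open_class: "a \<in> Field r \<Longrightarrow> openin X {y. E a x y}" "a \<in> Field r \<Longrightarrow> openin X (topspace X - {y. E a x y})"
  using open_saturated[of a "{y. E a x y}"] E_in E_trans by auto

text \<open>At a given point the sets require fewer than \<lambda> scales, and regularity provides
  one finer than all of them. This is the base case of \<open>Sig_INT_small\<close>.\<close>

lemma open_INT_small:
  assumes "|I| <o r" "\<And>i. i \<in> I \<Longrightarrow> openin X (A i)"
  shows "openin X (topspace X \<inter> (\<Inter>i\<in>I. A i))"
  unfolding open_iff
proof (intro conjI ballI)
  fix x assume x: "x \<in> topspace X \<inter> (\<Inter>i\<in>I. A i)"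
  have "\<exists>a\<in>Field r. \<forall>y. E a x y \<longrightarrow> y \<in> A i" if "i \<in> I" for i
    using assms(2)[OF that] x that unfolding open_iff by blast
  then obtain a where a: "\<And>i. i \<in> I \<Longrightarrow> a i \<in> Field r" "\<And>i y. i \<in> I \<Longrightarrow> E (a i) x y \<Longrightarrow> y \<in> A i"
    by metis
  obtain b where b: "b \<in> Field r" "a ` I \<subseteq> underS r b"
    using small_strictly_bounded[of "a ` I"] a(1) image_small[OF assms(1)] by blast
  have "\<forall>y. E b x y \<longrightarrow> y \<in> topspace X \<inter> (\<Inter>i\<in>I. A i)"
  proof (intro allI impI)
    fix y assume y: "E b x y"
    have "y \<in> A i" if "i \<in> I" for i
    proof -
      have "(a i, b) \<in> r" using b(2) that unfolding underS_def by blast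
      then show ?thesis using E_mono y a(2) that by blast
    qed
    then show "y \<in> topspace X \<inter> (\<Inter>i\<in>I. A i)" using E_in y by blast
  qed
  then show "\<exists>a\<in>Field r. \<forall>y. E a x y \<longrightarrow> y \<in> topspace X \<inter> (\<Inter>i\<in>I. A i)" using b(1) by blast
qed blast

text \<open>The \<open>a\<close>-th piece consists of the points whose whole \<open>a\<close>-class
  lies in \<open>U\<close>; it is saturated, hence clopen.\<close>

lemma open_eq_UN_clopen:
  assumes "openin X U"
  obtains A where "U = (\<Union>a\<in>Field r. A a)" "\<And>a. a \<in> Field r \<Longrightarrow> openin X (A a)"
    "\<And>a. a \<in> Field r \<Longrightarrow> openin X (topspace X - A a)"
proof
  let ?A = "\<lambda>a. {x \<in> U. \<forall>y. E a x y \<longrightarrow> y \<in> U}"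
  have U: "U \<subseteq> topspace X" using assms openin_subset by blast
  show "U = (\<Union>a\<in>Field r. ?A a)" using assms unfolding open_iff by blast
  have *: "y \<in> ?A a" if "a \<in> Field r" "x \<in> ?A a" "E a x y" for a x y
    using that E_trans by blast
  show "openin X (?A a)" "openin X (topspace X - ?A a)" if "a \<in> Field r" for a
    using open_saturated[OF that, of "?A a"] U * that by blast+
qed

abbreviation Sig :: "'l set \<Rightarrow> 'a set \<Rightarrow> bool" where "Sig \<equiv> sigma0 r X"

definition Pi0 :: "'l set \<Rightarrow> 'a set \<Rightarrow> bool" where
  "Pi0 \<xi> A \<longleftrightarrow> A \<subseteq> topspace X \<and> Sig \<xi> (topspace X - A)"

lemma Sig_one_iff: "Sig one U \<longleftrightarrow> openin X U"
  by (auto simp: oless_irrefl intro: sigma0_one elim: sigma0.cases)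

text \<open>Frees the step of the hierarchy from its indexing by \<open>Field r\<close>: any family
  of at most \<lambda> sets, even an empty one, is allowed.\<close>

lemma Sig_step_iff:
  assumes "one \<lhd> \<xi>"
  shows "Sig \<xi> A \<longleftrightarrow> (\<exists>\<A>. |\<A>| \<le>o r \<and> A = \<Union>\<A> \<and> (\<forall>B\<in>\<A>. \<exists>\<eta>. \<eta> \<lhd> \<xi> \<and> Pi0 \<eta> B))"
proof
  assume "Sig \<xi> A"
  then show "\<exists>\<A>. |\<A>| \<le>o r \<and> A = \<Union>\<A> \<and> (\<forall>B\<in>\<A>. \<exists>\<eta>. \<eta> \<lhd> \<xi> \<and> Pi0 \<eta> B)"
  proof cases
    case sigma0_one
    then show ?thesis using assms oless_irrefl by blast
  next
    case (sigma0_step B)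
    have "\<exists>\<eta>. \<eta> \<lhd> \<xi> \<and> Pi0 \<eta> (B i)" if "i \<in> Field r" for i
      using sigma0_step(4)[OF that] unfolding Pi0_def by blast
    then show ?thesis
      using image_le[OF Field_le] sigma0_step(1) by (intro exI[of _ "B ` Field r"]) auto
  qed
next
  assume "\<exists>\<A>. |\<A>| \<le>o r \<and> A = \<Union>\<A> \<and> (\<forall>B\<in>\<A>. \<exists>\<eta>. \<eta> \<lhd> \<xi> \<and> Pi0 \<eta> B)"
  then obtain \<A> where \<A>: "|\<A>| \<le>o r" "A = \<Union>\<A>" "\<And>B. B \<in> \<A> \<Longrightarrow> \<exists>\<eta>. \<eta> \<lhd> \<xi> \<and> Pi0 \<eta> B" by blast
  \<comment> \<open>The empty set is added to make the family nonempty, so that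
    \<open>Field r\<close> can enumerate it; the union is unchanged.\<close>
  have 0: "Pi0 one {}" unfolding Pi0_def Sig_one_iff by simp
  have "|insert {} \<A>| \<le>o r"
    using card_of_Un_ordLeq_infinite_Field[OF infinite_Field finite_le \<A>(1) card, of "{{}}"]
    by simp
  then obtain f where f: "f ` Field r = insert {} \<A>" using obtain_enum by blast
  have "Sig \<xi> (\<Union>i\<in>Field r. f i)"
  proof (rule sigma0_step)
    fix i assume "i \<in> Field r"
    then have "f i \<in> insert {} \<A>" using f by blast
    then consider "f i = {}" | "f i \<in> \<A>" by blast
    then have "\<exists>\<eta>. \<eta> \<lhd> \<xi> \<and> Pi0 \<eta> (f i)"
    proof cases
      case 1
      then show ?thesis using 0 assms by auto
    next
      case 2
      then show ?thesis by (rule \<A>(3))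
    qed
    then show "f i \<subseteq> topspace X \<and> (\<exists>\<xi>'\<in>underS s \<xi>. Sig \<xi>' (topspace X - f i))"
      unfolding Pi0_def by blast
  qed (use assms oless_Field in auto)
  also have "(\<Union>i\<in>Field r. f i) = A" using f \<A>(2) by auto
  finally show "Sig \<xi> A" .
qed

lemma Sig_Field: "Sig \<xi> A \<Longrightarrow> one \<unlhd> \<xi>"
  by (erule sigma0.cases) (use ole_refl one_Field oless_imp_ole in blast)+

lemma Sig_subset: "Sig \<xi> A \<Longrightarrow> A \<subseteq> topspace X"
  by (erule sigma0.cases) (use openin_subset in blast)+

text \<open>From \<xi> > 1 upwards the same union serves for \<eta>. Only open sets need an
  argument: they are unions of \<lambda> clopen sets, which belong to
  \<open>Pi0 one\<close>.\<close>

lemma Sig_mono: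
  assumes "Sig \<xi> A" "\<xi> \<unlhd> \<eta>"
  shows "Sig \<eta> A"
proof (cases "\<xi> = \<eta>")
  case False
  then have lt: "\<xi> \<lhd> \<eta>" using assms(2) ole_iff_oless_or_eq by blast
  have o\<eta>: "one \<lhd> \<eta>" using Sig_Field[OF assms(1)] lt by (rule ole_oless_trans)
  show ?thesis
  proof (cases "\<xi> = one")
    case True
    then have "openin X A" using assms(1) Sig_one_iff by blast
    then obtain B where B: "A = (\<Union>a\<in>Field r. B a)" "\<And>a. a \<in> Field r \<Longrightarrow> openin X (B a)"
      "\<And>a. a \<in> Field r \<Longrightarrow> openin X (topspace X - B a)" using open_eq_UN_clopen by blast
    have "Pi0 one (B a)" if "a \<in> Field r" for a
      using B(2,3)[OF that] openin_subset unfolding Pi0_def Sig_one_iff by blast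
    then show ?thesis unfolding Sig_step_iff[OF o\<eta>] using B(1) image_le[OF Field_le] o\<eta>
      by (intro exI[of _ "B ` Field r"]) auto
  next
    case False
    then have "one \<lhd> \<xi>" using Sig_Field[OF assms(1)] ole_iff_oless_or_eq by blast
    then obtain \<A> where \<A>: "|\<A>| \<le>o r" "A = \<Union>\<A>" "\<And>B. B \<in> \<A> \<Longrightarrow> \<exists>\<zeta>. \<zeta> \<lhd> \<xi> \<and> Pi0 \<zeta> B"
      using assms(1) Sig_step_iff[of \<xi> A] by blast
    have "\<exists>\<zeta>. \<zeta> \<lhd> \<eta> \<and> Pi0 \<zeta> B" if "B \<in> \<A>" for B
      using \<A>(3)[OF that] oless_ole_trans[OF _ assms(2)] by blast
    then show ?thesis unfolding Sig_step_iff[OF o\<eta>] using \<A>(1,2) by blast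
  qed
qed (use assms in simp)

lemma Pi0_mono: "Pi0 \<xi> A \<Longrightarrow> \<xi> \<unlhd> \<eta> \<Longrightarrow> Pi0 \<eta> A"
  unfolding Pi0_def using Sig_mono by blast

lemma Pi0_Field: "Pi0 \<xi> A \<Longrightarrow> one \<unlhd> \<xi>"
  unfolding Pi0_def using Sig_Field by blast

lemma open_imp_Sig: "openin X A \<Longrightarrow> one \<unlhd> \<xi> \<Longrightarrow> Sig \<xi> A"
  using Sig_one_iff Sig_mono by blast

lemma Sig_UN:
  assumes "|I| \<le>o r" "\<And>i. i \<in> I \<Longrightarrow> Sig \<xi> (A i)" "one \<unlhd> \<xi>"
  shows "Sig \<xi> (\<Union>i\<in>I. A i)"
proof (cases "\<xi> = one")
  case True
  then show ?thesis using assms(2) unfolding True Sig_one_iff by blast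
next
  case False
  then have o: "one \<lhd> \<xi>" using assms(3) ole_iff_oless_or_eq by blast
  have "\<forall>i\<in>I. \<exists>\<A>. |\<A>| \<le>o r \<and> A i = \<Union>\<A> \<and> (\<forall>B\<in>\<A>. \<exists>\<eta>. \<eta> \<lhd> \<xi> \<and> Pi0 \<eta> B)"
    using assms(2) unfolding Sig_step_iff[OF o] by blast
  from bchoice[OF this] obtain \<A> where \<A>: "\<forall>i\<in>I. |\<A> i| \<le>o r \<and> A i = \<Union>(\<A> i) \<and> (\<forall>B\<in>\<A> i. \<exists>\<eta>. \<eta> \<lhd> \<xi> \<and> Pi0 \<eta> B)" ..
  have "|\<Union>i\<in>I. \<A> i| \<le>o r" using \<A> by (intro UN_le[OF assms(1)]) blast
  moreover have "(\<Union>i\<in>I. A i) = \<Union>(\<Union>i\<in>I. \<A> i)" using \<A> by auto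
  moreover have "\<forall>B\<in>\<Union>i\<in>I. \<A> i. \<exists>\<eta>. \<eta> \<lhd> \<xi> \<and> Pi0 \<eta> B" using \<A> by simp
  ultimately show ?thesis unfolding Sig_step_iff[OF o] by (intro exI conjI)
qed

lemma Pi0_imp_Sig: "Pi0 \<xi> A \<Longrightarrow> \<xi> \<lhd> \<eta> \<Longrightarrow> Sig \<eta> A"
  using Sig_step_iff[OF ole_oless_trans[OF Pi0_Field]] finite_le[of "{A}"]
  by fastforce

lemma Sig_imp_Pi0: "Sig \<xi> A \<Longrightarrow> \<xi> \<lhd> \<eta> \<Longrightarrow> Pi0 \<eta> A"
  using Pi0_imp_Sig[of \<xi> "topspace X - A" \<eta>] Sig_subset[of \<xi> A]
  unfolding Pi0_def by (simp add: double_diff)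

lemma Pi0_INT:
  assumes "|I| \<le>o r" "\<And>i. i \<in> I \<Longrightarrow> Pi0 \<xi> (A i)" "one \<unlhd> \<xi>"
  shows "Pi0 \<xi> (topspace X \<inter> (\<Inter>i\<in>I. A i))"
proof -
  have "topspace X - (topspace X \<inter> (\<Inter>i\<in>I. A i)) = (\<Union>i\<in>I. topspace X - A i)" by blast
  then show ?thesis using Sig_UN[OF assms(1) _ assms(3), of "\<lambda>i. topspace X - A i"] assms(2)
    unfolding Pi0_def by auto
qed

text \<open>Distributing the unions leaves intersections of two sets, and the larger of their two
  levels is still below \<xi>. This works at every index, limits included, because only finitely
  many levels are compared.\<close>

lemma Sig_Int:
  assumes "Sig \<xi> A" "Sig \<xi> B"
  shows "Sig \<xi> (A \<inter> B)"
proof (cases "\<xi> = one")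
  case True
  then show ?thesis using assms unfolding True Sig_one_iff by blast
next
  case False
  then have o: "one \<lhd> \<xi>" using Sig_Field[OF assms(1)] ole_iff_oless_or_eq by blast
  obtain \<A> where \<A>: "|\<A>| \<le>o r" "A = \<Union>\<A>" "\<forall>B\<in>\<A>. \<exists>\<eta>. \<eta> \<lhd> \<xi> \<and> Pi0 \<eta> B"
    using assms(1) unfolding Sig_step_iff[OF o] by blast
  obtain \<B> where \<B>: "|\<B>| \<le>o r" "B = \<Union>\<B>" "\<forall>B\<in>\<B>. \<exists>\<eta>. \<eta> \<lhd> \<xi> \<and> Pi0 \<eta> B"
    using assms(2) unfolding Sig_step_iff[OF o] by blast
  let ?\<C> = "(\<lambda>(a, b). a \<inter> b) ` (\<A> \<times> \<B>)"
  have "|?\<C>| \<le>o r" using \<A>(1) \<B>(1) by (intro image_le Sigma_le)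
  moreover have "A \<inter> B = \<Union>?\<C>" using \<A>(2) \<B>(2) by auto
  moreover have "\<exists>\<eta>. \<eta> \<lhd> \<xi> \<and> Pi0 \<eta> (a \<inter> b)" if ab: "a \<in> \<A>" "b \<in> \<B>" for a b
  proof -
    obtain \<eta> \<theta> where h: "\<eta> \<lhd> \<xi>" "Pi0 \<eta> a" "\<theta> \<lhd> \<xi>" "Pi0 \<theta> b" using ab \<A>(3) \<B>(3) by blast
    obtain \<zeta> where z: "\<zeta> \<lhd> \<xi>" "Pi0 \<zeta> a" "Pi0 \<zeta> b"
      using h ole_or_oless[of \<eta> \<theta>] oless_Field Pi0_mono oless_imp_ole by metis
    have "Pi0 \<zeta> (topspace X \<inter> (\<Inter>i\<in>{a, b}. i))"
      by (rule Pi0_INT) (use z finite_le[of "{a, b}"] Pi0_Field in auto)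
    moreover have "topspace X \<inter> (\<Inter>i\<in>{a, b}. i) = a \<inter> b" using z unfolding Pi0_def by auto
    ultimately show ?thesis using z(1) by auto
  qed
  ultimately show ?thesis unfolding Sig_step_iff[OF o] by (intro exI[of _ ?\<C>]) auto
qed

lemma Sig_enum:
  assumes "Sig \<xi> A" "one \<lhd> \<xi>"
  obtains f where "\<And>j. j \<in> Field r \<Longrightarrow> \<exists>\<eta>. \<eta> \<lhd> \<xi> \<and> Pi0 \<eta> (f j)" "A = (\<Union>j\<in>Field r. f j)"
  using assms(1)
proof cases
  case sigma0_one
  then show ?thesis using assms(2) oless_irrefl by blast
next
  case (sigma0_step B)
  show ?thesis
  proof (rule that)
    show "\<exists>\<eta>. \<eta> \<lhd> \<xi> \<and> Pi0 \<eta> (B j)" if "j \<in> Field r" for j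
      using sigma0_step(4)[OF that] unfolding Pi0_def by blast
  qed (rule sigma0_step(1))
qed

lemma Sig_osuc_enum:
  assumes "Sig (osuc s \<eta>) A" "one \<unlhd> \<eta>"
  obtains f where "\<And>j. j \<in> Field r \<Longrightarrow> Pi0 \<eta> (f j)" "A = (\<Union>j\<in>Field r. f j)"
proof -
  have F: "\<eta> \<in> Field s" using assms(2) ole_Field by blast
  have o: "one \<lhd> osuc s \<eta>" using assms(2) oless_osuc_iff[OF F] by blast
  obtain f where f: "\<And>j. j \<in> Field r \<Longrightarrow> \<exists>\<zeta>. \<zeta> \<lhd> osuc s \<eta> \<and> Pi0 \<zeta> (f j)"
    "A = (\<Union>j\<in>Field r. f j)"
    using Sig_enum[OF assms(1) o] by blast
  show ?thesis
  proof (rule that[OF _ f(2)])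
    fix j assume "j \<in> Field r"
    then show "Pi0 \<eta> (f j)" using f(1) oless_osuc_iff[OF F] Pi0_mono by blast
  qed
qed

text \<open>The choice of one member from each of the \<open><\<lambda>\<close> unions is bounded by regularity, so the
  distributed union has at most \<open>\<lambda> \<sqdot> 2\<^bsup><\<lambda>\<^esup> = \<lambda>\<close> members. At limit indices of small
  cofinality the statement fails.\<close>

lemma Sig_INT_small:
  assumes "\<eta> \<in> Field s" "|I| <o r" "\<And>i. i \<in> I \<Longrightarrow> Sig (osuc s \<eta>) (A i)"
  shows "Sig (osuc s \<eta>) (topspace X \<inter> (\<Inter>i\<in>I. A i))"
proof (cases "\<eta> = ozero s")
  case True
  then show ?thesis using assms(3) open_INT_small[OF assms(2)] unfolding True Sig_one_iff by blast
next
  case False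
  then have o: "one \<unlhd> \<eta>" using one_le assms(1) by blast
  have "\<forall>i\<in>I. \<exists>f. (\<forall>j\<in>Field r. Pi0 \<eta> (f j)) \<and> A i = (\<Union>j\<in>Field r. f j)"
    using Sig_osuc_enum[OF assms(3) o] by metis
  from bchoice[OF this] obtain f where
    f: "\<forall>i\<in>I. (\<forall>j\<in>Field r. Pi0 \<eta> (f i j)) \<and> A i = (\<Union>j\<in>Field r. f i j)" ..
  \<comment> \<open>A choice is coded as a relation \<open>S\<close> that meets every
    \<open>i\<close>, not as a function, so that the codes lie in the powerset of a set of size less
    than \<lambda>. If \<open>S\<close> offers several \<open>j\<close> for one \<open>i\<close>,
    \<open>B S\<close> only becomes smaller. The index \<open>b\<close> bounds the choices.\<close>
  define J where "J = Sigma (Field r) (\<lambda>b. {S \<in> Pow (I \<times> underS r b). \<forall>i\<in>I. \<exists>j. (i, j) \<in> S})"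
  define B where "B S = topspace X \<inter> (\<Inter>(i, j)\<in>S. f i j)" for S
  have K: "|I \<times> underS r b| <o r" for b using assms(2) underS_small by (intro Sigma_small)
  have "|{S \<in> Pow (I \<times> underS r b). \<forall>i\<in>I. \<exists>j. (i, j) \<in> S}| \<le>o r" for b
    by (rule subset_le[OF Pow_small_le[OF K]]) blast
  then have J: "|J| \<le>o r" unfolding J_def by (intro Sigma_le Field_le)
  have S: "Sig (osuc s \<eta>) (B (snd p))" if "p \<in> J" for p
  proof -
    obtain b S where p: "p = (b, S)" by (cases p)
    have bS: "b \<in> Field r" "S \<subseteq> I \<times> underS r b" using that unfolding J_def p by auto
    have sub: "underS r b \<subseteq> Field r" unfolding underS_def Field_def by auto
    have "Pi0 \<eta> (topspace X \<inter> (\<Inter>q\<in>S. case q of (i, j) \<Rightarrow> f i j))"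
    proof (rule Pi0_INT[OF _ _ o])
      show "|S| \<le>o r" by (rule small_imp_le[OF subset_small[OF K bS(2)]])
      fix q assume q: "q \<in> S"
      obtain i j where ij: "q = (i, j)" by (cases q)
      have "i \<in> I" "j \<in> Field r" using q bS(2) sub unfolding ij by auto
      then show "Pi0 \<eta> (case q of (i, j) \<Rightarrow> f i j)" using f unfolding ij by simp
    qed
    then show ?thesis unfolding B_def p using Pi0_imp_Sig oless_osuc[OF assms(1)] by simp
  qed
  have "topspace X \<inter> (\<Inter>i\<in>I. A i) = (\<Union>p\<in>J. B (snd p))"
  proof (intro equalityI subsetI)
    fix x assume x: "x \<in> topspace X \<inter> (\<Inter>i\<in>I. A i)"
    have "\<forall>i\<in>I. \<exists>j. j \<in> Field r \<and> x \<in> f i j" using x f by auto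
    from bchoice[OF this] obtain j where j: "\<forall>i\<in>I. j i \<in> Field r \<and> x \<in> f i (j i)" ..
    obtain b where b: "b \<in> Field r" "j ` I \<subseteq> underS r b"
      using small_strictly_bounded[of "j ` I"] j image_small[OF assms(2)] by blast
    let ?S = "(\<lambda>i. (i, j i)) ` I"
    have "(b, ?S) \<in> J" unfolding J_def using b by auto
    moreover have "x \<in> B ?S" unfolding B_def using x j by auto
    ultimately show "x \<in> (\<Union>p\<in>J. B (snd p))" by force
  next
    fix x assume "x \<in> (\<Union>p\<in>J. B (snd p))"
    then obtain b S where bS: "(b, S) \<in> J" "x \<in> B S" by auto
    have sub: "underS r b \<subseteq> Field r" unfolding underS_def Field_def by auto
    have "x \<in> A i" if i: "i \<in> I" for i
    proof -
      obtain j where j: "(i, j) \<in> S" using bS(1) i unfolding J_def by auto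
      then have "j \<in> Field r" using bS(1) sub unfolding J_def by auto
      moreover have "x \<in> f i j" using bS(2) j unfolding B_def by auto
      ultimately show ?thesis using f i by auto
    qed
    then show "x \<in> topspace X \<inter> (\<Inter>i\<in>I. A i)" using bS(2) unfolding B_def by auto
  qed
  then show ?thesis using Sig_UN[OF J S one_le_osuc[OF assms(1)]] by simp
qed

section \<open>Ambiguous sets and their Boolean combinations\<close>

text \<open>The ambiguous class at \<eta>, stated for predicates so that the complexity of a
  compound condition can be read off its logical form. Only values on the space matter.\<close>

definition Delta :: "'l set \<Rightarrow> ('a \<Rightarrow> bool) \<Rightarrow> bool" where
  "Delta \<eta> \<phi> \<longleftrightarrow> Sig \<eta> {x \<in> topspace X. \<phi> x} \<and> Sig \<eta> {x \<in> topspace X. \<not> \<phi> x}"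

lemma Delta_mono: "Delta \<eta> \<phi> \<Longrightarrow> \<eta> \<unlhd> \<zeta> \<Longrightarrow> Delta \<zeta> \<phi>"
  unfolding Delta_def using Sig_mono by blast

lemma Delta_not: "Delta \<eta> \<phi> \<Longrightarrow> Delta \<eta> (\<lambda>x. \<not> \<phi> x)"
  unfolding Delta_def by simp

lemma Delta_const: "one \<unlhd> \<eta> \<Longrightarrow> Delta \<eta> (\<lambda>x. c)"
  unfolding Delta_def using open_imp_Sig[OF openin_topspace] open_imp_Sig[OF openin_empty]
  by (cases c) auto

text \<open>The negation is a union; the condition itself is an intersection of fewer than \<lambda>
  sets, which is why the index is a successor.\<close>

lemma Delta_Ball:
  assumes "\<eta> \<in> Field s" "|I| <o r" "\<And>i. i \<in> I \<Longrightarrow> Delta (osuc s \<eta>) (\<phi> i)"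
  shows "Delta (osuc s \<eta>) (\<lambda>x. \<forall>i\<in>I. \<phi> i x)"
proof -
  have 1: "{x \<in> topspace X. \<forall>i\<in>I. \<phi> i x} = topspace X \<inter> (\<Inter>i\<in>I. {x \<in> topspace X. \<phi> i x})"
    by auto
  have 2: "{x \<in> topspace X. \<not> (\<forall>i\<in>I. \<phi> i x)} = (\<Union>i\<in>I. {x \<in> topspace X. \<not> \<phi> i x})"
    by auto
  show ?thesis unfolding Delta_def 1 2
    using Sig_INT_small[OF assms(1,2), of "\<lambda>i. {x \<in> topspace X. \<phi> i x}"]
      Sig_UN[OF small_imp_le[OF assms(2)] _ one_le_osuc[OF assms(1)], of "\<lambda>i. {x \<in> topspace X. \<not> \<phi> i x}"]
      assms(3) unfolding Delta_def by blast
qed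

lemma Delta_Bex:
  assumes "\<eta> \<in> Field s" "|I| <o r" "\<And>i. i \<in> I \<Longrightarrow> Delta (osuc s \<eta>) (\<phi> i)"
  shows "Delta (osuc s \<eta>) (\<lambda>x. \<exists>i\<in>I. \<phi> i x)"
  using Delta_not[OF Delta_Ball[OF assms(1,2), of "\<lambda>i x. \<not> \<phi> i x"]] Delta_not assms(3) by simp

lemma Delta_conj:
  assumes "\<eta> \<in> Field s" "Delta (osuc s \<eta>) \<phi>" "Delta (osuc s \<eta>) \<psi>"
  shows "Delta (osuc s \<eta>) (\<lambda>x. \<phi> x \<and> \<psi> x)"
  using Delta_Ball[OF assms(1) finite_small[of "{\<phi>, \<psi>}"], of "\<lambda>f x. f x"] assms(2,3) by auto

lemma Delta_disj:
  assumes "\<eta> \<in> Field s" "Delta (osuc s \<eta>) \<phi>" "Delta (osuc s \<eta>) \<psi>"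
  shows "Delta (osuc s \<eta>) (\<lambda>x. \<phi> x \<or> \<psi> x)"
  using Delta_Bex[OF assms(1) finite_small[of "{\<phi>, \<psi>}"], of "\<lambda>f x. f x"] assms(2,3) by auto

text \<open>Serves to express that the answer at a point agrees with the one prescribed by a fixed
  pattern.\<close>

lemma Delta_iff_const:
  assumes "Delta \<eta> \<phi>"
  shows "Delta \<eta> (\<lambda>x. \<phi> x \<longleftrightarrow> c)"
  using assms Delta_not by (cases c) auto

lemma Sig_imp_Delta:
  assumes "Sig \<eta> A" "\<eta> \<lhd> \<zeta>"
  shows "Delta \<zeta> (\<lambda>x. x \<in> A)"
proof -
  have "{x \<in> topspace X. x \<in> A} = A" "{x \<in> topspace X. x \<notin> A} = topspace X - A"
    using Sig_subset[OF assms(1)] by auto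
  then show ?thesis unfolding Delta_def
    using Sig_mono[OF assms(1) oless_imp_ole[OF assms(2)]] Sig_imp_Pi0[OF assms] unfolding Pi0_def by auto
qed

text \<open>The complement is a union of \<lambda> Pi-sets of levels \<eta> < \<xi>, each of which
  is ambiguous one level higher. The index \<eta>+1 is harmless, since functions of Baire class
  \<eta> are measurable at \<eta>+1. For \<xi> = 1 the sets are clopen and \<eta> is zero.\<close>

lemma Pi0_eq_INT_Delta:
  assumes "Pi0 \<xi> P"
  obtains R where "P = topspace X \<inter> (\<Inter>j\<in>Field r. R j)"
    "\<And>j. j \<in> Field r \<Longrightarrow> \<exists>\<eta>. \<eta> \<lhd> \<xi> \<and> Delta (osuc s \<eta>) (\<lambda>x. x \<in> R j)"
proof (cases "\<xi> = one")
  case True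
  have "openin X (topspace X - P)" using assms unfolding True Pi0_def Sig_one_iff by blast
  then obtain A where A: "topspace X - P = (\<Union>a\<in>Field r. A a)" "\<And>a. a \<in> Field r \<Longrightarrow> openin X (A a)"
    "\<And>a. a \<in> Field r \<Longrightarrow> openin X (topspace X - A a)" using open_eq_UN_clopen by blast
  show ?thesis
  proof (rule that[of "\<lambda>a. topspace X - A a"])
    show "P = topspace X \<inter> (\<Inter>a\<in>Field r. topspace X - A a)"
      using A(1) assms unfolding Pi0_def by blast
    fix a assume a: "a \<in> Field r"
    have "{x \<in> topspace X. x \<in> topspace X - A a} = topspace X - A a"
      "{x \<in> topspace X. x \<notin> topspace X - A a} = A a" using openin_subset[OF A(2)[OF a]] by auto
    then have "Delta one (\<lambda>x. x \<in> topspace X - A a)"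
      unfolding Delta_def Sig_one_iff using A(2,3)[OF a] by simp
    then show "\<exists>\<eta>. \<eta> \<lhd> \<xi> \<and> Delta (osuc s \<eta>) (\<lambda>x. x \<in> topspace X - A a)"
      unfolding True using oless_osuc[OF ozero_Field] by blast
  qed
next
  case False
  then have o: "one \<lhd> \<xi>" using Pi0_Field[OF assms] ole_iff_oless_or_eq by blast
  obtain A where A: "\<And>j. j \<in> Field r \<Longrightarrow> \<exists>\<eta>. \<eta> \<lhd> \<xi> \<and> Pi0 \<eta> (A j)"
    "topspace X - P = (\<Union>j\<in>Field r. A j)"
    using Sig_enum[OF _ o, of "topspace X - P"] assms unfolding Pi0_def by blast
  show ?thesis
  proof (rule that[of "\<lambda>a. topspace X - A a"])
    show "P = topspace X \<inter> (\<Inter>a\<in>Field r. topspace X - A a)"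
      using A(2) assms unfolding Pi0_def by blast
    fix a assume a: "a \<in> Field r"
    obtain \<eta> where \<eta>: "\<eta> \<lhd> \<xi>" "Pi0 \<eta> (A a)" using A(1)[OF a] by blast
    then have "Delta (osuc s \<eta>) (\<lambda>x. x \<in> topspace X - A a)"
      using Sig_imp_Delta[OF _ oless_osuc[OF oless_Field(1)[OF \<eta>(1)]]] unfolding Pi0_def by blast
    then show "\<exists>\<eta>. \<eta> \<lhd> \<xi> \<and> Delta (osuc s \<eta>) (\<lambda>x. x \<in> topspace X - A a)" using \<eta>(1) by blast
  qed
qed

end

section \<open>Measurable functions and their limits\<close>

text \<open>\<open>dense\<close> is the form in which the weight of \<open>Y\<close> is used: one
  set of representatives for all scales. \<open>spherical\<close> is spherical completeness for
  coherent choices of classes along an arbitrary nonempty set of indices.\<close>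

locale nested_pair = X: nested_space r X E + Y: nested_space r Y F
  for r :: "'l rel" and X :: "'a topology" and E and Y :: "'b topology" and F +
  assumes dense: "\<exists>Q. Q \<subseteq> topspace Y \<and> |Q| \<le>o r \<and> (\<forall>a\<in>Field r. \<forall>y\<in>topspace Y. \<exists>q\<in>Q. F a q y)"
    and spherical: "\<And>B z. B \<subseteq> Field r \<Longrightarrow> B \<noteq> {} \<Longrightarrow>
      (\<And>a b. a \<in> B \<Longrightarrow> b \<in> B \<Longrightarrow> (a, b) \<in> r \<Longrightarrow> F a (z a) (z b)) \<Longrightarrow> \<exists>y. \<forall>a\<in>B. F a (z a) y"
begin

abbreviation Meas :: "'l set \<Rightarrow> ('a \<Rightarrow> 'b) set" where "Meas \<xi> \<equiv> measurable_fun r X Y \<xi>"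

text \<open>Under the induction hypothesis this is the union of all earlier Baire classes. At a
  limit \<xi> each member has a single level below \<xi>, which membership in
  \<open>Meas \<xi>\<close> does not ask for.\<close>

abbreviation Meas_below :: "'l set \<Rightarrow> ('a \<Rightarrow> 'b) set" where
  "Meas_below \<xi> \<equiv> (\<Union>\<eta>\<in>underS X.s \<xi>. Meas (osuc X.s \<eta>))"

lemma Meas_mono: "f \<in> Meas \<xi> \<Longrightarrow> X.ole \<xi> \<eta> \<Longrightarrow> f \<in> Meas \<eta>"
  unfolding measurable_fun_def using X.Sig_mono by blast

lemma Meas_below_subset: "Meas_below \<xi> \<subseteq> Meas \<xi>"
  using Meas_mono X.osuc_least by blast

text \<open>Every open set is the union of the classes contained in it that have a representative in
  the dense set, and there are at most \<lambda> of these.\<close>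

lemma MeasI:
  assumes f: "f \<in> topspace X \<rightarrow>\<^sub>E topspace Y" and o: "X.ole X.one \<xi>"
    and "\<And>a q. a \<in> Field r \<Longrightarrow> q \<in> topspace Y \<Longrightarrow> X.Sig \<xi> {x \<in> topspace X. F a q (f x)}"
  shows "f \<in> Meas \<xi>"
  unfolding measurable_fun_def
proof (intro CollectI conjI allI impI f)
  fix U assume U: "openin Y U"
  obtain Q where Q: "Q \<subseteq> topspace Y" "|Q| \<le>o r"
    "\<And>a y. a \<in> Field r \<Longrightarrow> y \<in> topspace Y \<Longrightarrow> \<exists>q\<in>Q. F a q y"
    using dense by blast
  define J where "J = {p \<in> Field r \<times> Q. \<forall>y. F (fst p) (snd p) y \<longrightarrow> y \<in> U}"
  have J: "|J| \<le>o r"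
    by (rule X.subset_le[OF X.Sigma_le[OF X.Field_le Q(2)]]) (auto simp: J_def)
  have "{x \<in> topspace X. f x \<in> U} = (\<Union>p\<in>J. {x \<in> topspace X. F (fst p) (snd p) (f x)})"
  proof (intro equalityI subsetI)
    fix x assume x: "x \<in> {x \<in> topspace X. f x \<in> U}"
    then obtain a where a: "a \<in> Field r" "\<And>y. F a (f x) y \<Longrightarrow> y \<in> U"
      using U unfolding Y.open_iff by blast
    have "f x \<in> topspace Y" using f x by (auto simp: PiE_iff)
    then obtain q where q: "q \<in> Q" "F a q (f x)" using Q(3) a(1) by blast
    have "(a, q) \<in> J" unfolding J_def using a q Y.E_trans[OF Y.E_sym[OF q(2)]] by auto
    then show "x \<in> (\<Union>p\<in>J. {x \<in> topspace X. F (fst p) (snd p) (f x)})" using x q by force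
  qed (auto simp: J_def)
  moreover have "X.Sig \<xi> (\<Union>p\<in>J. {x \<in> topspace X. F (fst p) (snd p) (f x)})"
    by (rule X.Sig_UN[OF J _ o], rule assms(3)) (use Q(1) in \<open>auto simp: J_def\<close>)
  ultimately show "X.Sig \<xi> {x \<in> topspace X. f x \<in> U}" by simp
qed

lemma Meas_Sig: "f \<in> Meas \<xi> \<Longrightarrow> openin Y U \<Longrightarrow> X.Sig \<xi> {x \<in> topspace X. f x \<in> U}"
  unfolding measurable_fun_def by blast

lemma Meas_funcset: "f \<in> Meas \<xi> \<Longrightarrow> f \<in> topspace X \<rightarrow>\<^sub>E topspace Y"
  unfolding measurable_fun_def by blast

lemma Meas_Pi0_class:
  assumes "f \<in> Meas \<xi>" "a \<in> Field r"
  shows "X.Pi0 \<xi> {x \<in> topspace X. F a q (f x)}"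
proof -
  have "topspace X - {x \<in> topspace X. F a q (f x)} = {x \<in> topspace X. f x \<in> topspace Y - {y. F a q y}}"
    using Meas_funcset[OF assms(1)] by (auto simp: PiE_iff)
  then show ?thesis
    using Meas_Sig[OF assms(1) Y.open_class(2)[OF assms(2), of q]] unfolding X.Pi0_def by auto
qed

section \<open>Measurability of limits\<close>

text \<open>By reflexivity of \<open>D\<close> the limit equals \<open>g d\<close> on
  \<open>C d\<close>, so a preimage is a union of intersections of two Sigma-sets. Unlike
  \<open>net_lim\<close>, this raises no level.\<close>

lemma hat_lim_subset_Meas:
  assumes "\<F> \<subseteq> Meas \<xi>" "|Field D| \<le>o r" "\<And>d. d \<in> Field D \<Longrightarrow> (d, d) \<in> D" "X.ole X.one \<xi>"
  shows "hat_lim r \<xi> D X Y \<F> \<subseteq> Meas \<xi>"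
proof
  fix f assume "f \<in> hat_lim r \<xi> D X Y \<F>"
  then obtain g C where f: "f \<in> topspace X \<rightarrow>\<^sub>E topspace Y" and g: "\<forall>d\<in>Field D. g d \<in> \<F>"
    and C: "(\<Union>d\<in>Field D. C d) = topspace X" "\<forall>d\<in>Field D. X.Sig \<xi> (C d)"
    and eq: "\<forall>(d, d')\<in>D. \<forall>x\<in>C d. g d' x = f x"
    unfolding hat_lim_def by blast
  show "f \<in> Meas \<xi>" unfolding measurable_fun_def
  proof (intro CollectI conjI allI impI f)
    fix U assume U: "openin Y U"
    have gf: "g d x = f x" if "d \<in> Field D" "x \<in> C d" for d x
      using eq assms(3)[OF that(1)] that(2) by fastforce
    have "{x \<in> topspace X. f x \<in> U} = (\<Union>d\<in>Field D. C d \<inter> {x \<in> topspace X. g d x \<in> U})"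
      using gf C(1) by force
    moreover have "X.Sig \<xi> (\<Union>d\<in>Field D. C d \<inter> {x \<in> topspace X. g d x \<in> U})"
    proof (rule X.Sig_UN[OF assms(2) _ assms(4)])
      fix d assume d: "d \<in> Field D"
      have "g d \<in> Meas \<xi>" using g d assms(1) by blast
      then show "X.Sig \<xi> (C d \<inter> {x \<in> topspace X. g d x \<in> U})"
        using X.Sig_Int Meas_Sig U C(2) d by blast
    qed
    ultimately show "X.Sig \<xi> {x \<in> topspace X. f x \<in> U}" by simp
  qed
qed

text \<open>The value \<open>f x\<close> lies in a class if and only if \<open>g d x\<close> does
  for all \<open>d\<close> beyond some \<open>d0\<close>. The backward direction applies convergence
  to the complement of the class, which is open too, and then directedness. The inner intersection
  is a Pi-set at \<xi> because classes are clopen.\<close>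

lemma net_lim_subset_Meas:
  assumes "\<F> \<subseteq> Meas \<xi>" "|Field D| \<le>o r" "directed_rel D" "X.ole X.one \<xi>"
  shows "net_lim D X Y \<F> \<subseteq> Meas (osuc X.s \<xi>)"
proof
  fix f assume "f \<in> net_lim D X Y \<F>"
  then obtain g where f: "f \<in> topspace X \<rightarrow>\<^sub>E topspace Y" and g: "\<forall>d\<in>Field D. g d \<in> \<F>"
    and conv: "\<forall>x\<in>topspace X. \<forall>U. openin Y U \<and> f x \<in> U \<longrightarrow>
      (\<exists>d0\<in>Field D. \<forall>d. (d0, d) \<in> D \<longrightarrow> g d x \<in> U)"
    unfolding net_lim_def by blast
  have lim: "\<exists>d0\<in>Field D. \<forall>d. (d0, d) \<in> D \<longrightarrow> g d x \<in> U"
    if "x \<in> topspace X" "openin Y U" "f x \<in> U" for x U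
    using bspec[OF conv that(1)] that(2,3) by blast
  have \<xi>: "\<xi> \<in> Field X.s" using assms(4) X.ole_Field by blast
  show "f \<in> Meas (osuc X.s \<xi>)"
  proof (rule MeasI[OF f X.one_le_osuc[OF \<xi>]])
    fix a q assume a: "a \<in> Field r" and q: "q \<in> topspace Y"
    define A where "A d0 = topspace X \<inter> (\<Inter>d\<in>{d. (d0, d) \<in> D}. {x \<in> topspace X. F a q (g d x)})" for d0
    have "{x \<in> topspace X. F a q (f x)} = (\<Union>d0\<in>Field D. A d0)"
    proof (intro equalityI subsetI)
      fix x assume x: "x \<in> {x \<in> topspace X. F a q (f x)}"
      then obtain d0 where "d0 \<in> Field D" "\<And>d. (d0, d) \<in> D \<Longrightarrow> g d x \<in> {y. F a q y}"
        using lim[OF _ Y.open_class(1)[OF a], of x q] by auto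
      then show "x \<in> (\<Union>d0\<in>Field D. A d0)" unfolding A_def using x by auto
    next
      fix x assume "x \<in> (\<Union>d0\<in>Field D. A d0)"
      then obtain d0 where d0: "d0 \<in> Field D" "x \<in> topspace X" "\<And>d. (d0, d) \<in> D \<Longrightarrow> F a q (g d x)"
        unfolding A_def by auto
      have "F a q (f x)"
      proof (rule ccontr)
        assume n: "\<not> F a q (f x)"
        have "f x \<in> topspace Y" using f d0(2) by (auto simp: PiE_iff)
        then obtain d1 where d1: "d1 \<in> Field D" "\<And>d. (d1, d) \<in> D \<Longrightarrow> g d x \<in> topspace Y - {y. F a q y}"
          using lim[OF d0(2) Y.open_class(2)[OF a], of q] n by auto
        obtain d where "(d0, d) \<in> D" "(d1, d) \<in> D"
          using assms(3) d0(1) d1(1) unfolding directed_rel_def by blast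
        then show False using d0(3) d1(2) by blast
      qed
      then show "x \<in> {x \<in> topspace X. F a q (f x)}" using d0 by blast
    qed
    moreover have "X.Sig (osuc X.s \<xi>) (\<Union>d0\<in>Field D. A d0)"
    proof (rule X.Sig_UN[OF assms(2) _ X.one_le_osuc[OF \<xi>]])
      fix d0 assume "d0 \<in> Field D"
      have sub: "{d. (d0, d) \<in> D} \<subseteq> Field D" unfolding Field_def by auto
      have "X.Pi0 \<xi> (A d0)" unfolding A_def
      proof (rule X.Pi0_INT[OF X.subset_le[OF assms(2) sub] _ assms(4)])
        fix d assume "d \<in> {d. (d0, d) \<in> D}"
        then have "g d \<in> Meas \<xi>" using g sub assms(1) by blast
        then show "X.Pi0 \<xi> {x \<in> topspace X. F a q (g d x)}" by (rule Meas_Pi0_class[OF _ a])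
      qed
      then show "X.Sig (osuc X.s \<xi>) (A d0)" by (rule X.Pi0_imp_Sig[OF _ X.oless_osuc[OF \<xi>]])
    qed
    ultimately show "X.Sig (osuc X.s \<xi>) {x \<in> topspace X. F a q (f x)}" by simp
  qed
qed

section \<open>Approximation along \<lambda>\<close>

text \<open>The preimage of the class of each dense point is a union of \<lambda> Pi-sets; all
  pieces are enumerated together, and \<open>v\<close> remembers the dense point from which a piece
  came. The pieces may overlap.\<close>

lemma Meas_Pi0_cover:
  assumes f: "f \<in> Meas (osuc X.s \<xi>)" and o: "X.ole X.one \<xi>" and ne: "topspace Y \<noteq> {}"
    and a: "a \<in> Field r"
  obtains P v where "\<And>k. k \<in> Field r \<Longrightarrow> X.Pi0 \<xi> (P k)"
    "topspace X = (\<Union>k\<in>Field r. P k)"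
    "\<And>k x. k \<in> Field r \<Longrightarrow> x \<in> P k \<Longrightarrow> F a (v k) (f x)"
proof -
  obtain Q where Q: "Q \<subseteq> topspace Y" "|Q| \<le>o r" "\<And>y. y \<in> topspace Y \<Longrightarrow> \<exists>q\<in>Q. F a q y"
    using dense a by blast
  have "Q \<noteq> {}" using Q(3) ne by blast
  have "\<forall>q\<in>Q. \<exists>h. (\<forall>j\<in>Field r. X.Pi0 \<xi> (h j)) \<and> {x \<in> topspace X. f x \<in> {y. F a q y}} = (\<Union>j\<in>Field r. h j)"
  proof
    fix q assume "q \<in> Q"
    obtain h where "\<And>j. j \<in> Field r \<Longrightarrow> X.Pi0 \<xi> (h j)"
      "{x \<in> topspace X. f x \<in> {y. F a q y}} = (\<Union>j\<in>Field r. h j)"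
      using X.Sig_osuc_enum[OF Meas_Sig[OF f Y.open_class(1)[OF a]] o] by blast
    then show "\<exists>h. (\<forall>j\<in>Field r. X.Pi0 \<xi> (h j)) \<and> {x \<in> topspace X. f x \<in> {y. F a q y}} = (\<Union>j\<in>Field r. h j)"
      by blast
  qed
  from bchoice[OF this] obtain h where
    h: "\<forall>q\<in>Q. (\<forall>j\<in>Field r. X.Pi0 \<xi> (h q j)) \<and> {x \<in> topspace X. f x \<in> {y. F a q y}} = (\<Union>j\<in>Field r. h q j)" ..
  have "Field r \<noteq> {}" using X.infinite_Field by auto
  then have "Q \<times> Field r \<noteq> {}" using \<open>Q \<noteq> {}\<close> by blast
  then obtain e where e: "e ` Field r = Q \<times> Field r"
    using X.obtain_enum[OF X.Sigma_le[OF Q(2) X.Field_le]] by blast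
  have ek: "fst (e k) \<in> Q" "snd (e k) \<in> Field r" if "k \<in> Field r" for k
    using e that by (metis imageI mem_Times_iff)+
  show ?thesis
  proof
    show "X.Pi0 \<xi> (h (fst (e k)) (snd (e k)))" if "k \<in> Field r" for k using h ek[OF that] by blast
    show "F a (fst (e k)) (f x)" if "k \<in> Field r" "x \<in> h (fst (e k)) (snd (e k))" for k x
      using h ek[OF that(1)] that(2) by auto
    show "topspace X = (\<Union>k\<in>Field r. h (fst (e k)) (snd (e k)))"
    proof (intro equalityI subsetI)
      fix x assume x: "x \<in> topspace X"
      then have "f x \<in> topspace Y" using Meas_funcset[OF f] by (auto simp: PiE_iff)
      then obtain q where q: "q \<in> Q" "F a q (f x)" using Q(3) by blast
      have "x \<in> {x \<in> topspace X. f x \<in> {y. F a q y}}" using x q(2) by simp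
      then have "x \<in> (\<Union>j\<in>Field r. h q j)"
        by (rule subsetD[OF equalityD1[OF conjunct2[OF bspec[OF h q(1)]]]])
      then obtain j where j: "j \<in> Field r" "x \<in> h q j" by blast
      obtain k where "k \<in> Field r" "e k = (q, j)" using e q(1) j(1) by (metis SigmaI imageE)
      then show "x \<in> (\<Union>k\<in>Field r. h (fst (e k)) (snd (e k)))" using j(2) by force
    next
      fix x assume "x \<in> (\<Union>k\<in>Field r. h (fst (e k)) (snd (e k)))"
      then obtain k where k: "k \<in> Field r" "x \<in> h (fst (e k)) (snd (e k))" by blast
      have "X.Pi0 \<xi> (h (fst (e k)) (snd (e k)))" using h ek[OF k(1)] by blast
      then show "x \<in> topspace X" using k(2) unfolding X.Pi0_def by blast
    qed
  qed
qed

lemma Meas_Pi0_covers: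
  assumes f: "f \<in> Meas (osuc X.s \<xi>)" and o: "X.ole X.one \<xi>" and ne: "topspace Y \<noteq> {}"
  obtains P v where "\<And>a k. a \<in> Field r \<Longrightarrow> k \<in> Field r \<Longrightarrow> X.Pi0 \<xi> (P a k)"
    "\<And>a x. a \<in> Field r \<Longrightarrow> x \<in> topspace X \<Longrightarrow> \<exists>k\<in>Field r. x \<in> P a k"
    "\<And>a k x. a \<in> Field r \<Longrightarrow> k \<in> Field r \<Longrightarrow> x \<in> P a k \<Longrightarrow> F a (v a k) (f x)"
proof -
  have "\<forall>a\<in>Field r. \<exists>Pv. (\<forall>k\<in>Field r. X.Pi0 \<xi> (fst Pv k)) \<and> topspace X = (\<Union>k\<in>Field r. fst Pv k) \<and>
    (\<forall>k\<in>Field r. \<forall>x\<in>fst Pv k. F a (snd Pv k) (f x))"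
  proof
    fix a assume a: "a \<in> Field r"
    obtain P v where Pv: "\<And>k. k \<in> Field r \<Longrightarrow> X.Pi0 \<xi> (P k)" "topspace X = (\<Union>k\<in>Field r. P k)"
      "\<And>k x. k \<in> Field r \<Longrightarrow> x \<in> P k \<Longrightarrow> F a (v k) (f x)"
      using Meas_Pi0_cover[OF f o ne a] by blast
    show "\<exists>Pv. (\<forall>k\<in>Field r. X.Pi0 \<xi> (fst Pv k)) \<and> topspace X = (\<Union>k\<in>Field r. fst Pv k) \<and>
      (\<forall>k\<in>Field r. \<forall>x\<in>fst Pv k. F a (snd Pv k) (f x))"
      by (rule exI[of _ "(P, v)"]) (use Pv in auto)
  qed
  from bchoice[OF this] obtain Pv where Pv:
    "\<forall>a\<in>Field r. (\<forall>k\<in>Field r. X.Pi0 \<xi> (fst (Pv a) k)) \<and> topspace X = (\<Union>k\<in>Field r. fst (Pv a) k) \<and>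
      (\<forall>k\<in>Field r. \<forall>x\<in>fst (Pv a) k. F a (snd (Pv a) k) (f x))" ..
  define P where "P a = fst (Pv a)" for a
  define v where "v a = snd (Pv a)" for a
  have P1: "X.Pi0 \<xi> (P a k)" if "a \<in> Field r" "k \<in> Field r" for a k
    using Pv that unfolding P_def by blast
  have P2: "\<exists>k\<in>Field r. x \<in> P a k" if "a \<in> Field r" "x \<in> topspace X" for a x
  proof -
    have "x \<in> (\<Union>k\<in>Field r. fst (Pv a) k)"
      by (rule subsetD[OF equalityD1[OF conjunct1[OF conjunct2[OF bspec[OF Pv that(1)]]]] that(2)])
    then show ?thesis unfolding P_def by blast
  qed
  have P3: "F a (v a k) (f x)" if "a \<in> Field r" "k \<in> Field r" "x \<in> P a k" for a k x
    using Pv that unfolding P_def v_def by blast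
  show ?thesis by (rule that[OF P1 P2 P3])
qed

end

context nested_pair
begin

text \<open>At stage \<open>\<gamma>\<close> only \<open>|\<gamma>|\<close> many \<open>\<Delta>\<close>-sets are consulted, so there are at most \<open>2\<^bsup><\<lambda>\<^esup>\<close>
  answer patterns \<open>T\<close> and the approximation is constant on each of them. For every \<open>a\<close> the least
  \<open>k\<close> not yet refuted stabilises, by regularity, at the least \<open>k\<close> with \<open>x \<in> P a k\<close>.\<close>

lemma Meas_subset_net_lim:
  assumes f: "f \<in> Meas (osuc X.s \<xi>)" and o: "X.ole X.one \<xi>" and ne: "topspace Y \<noteq> {}"
    and bdd: "\<And>H. H \<subseteq> underS X.s \<xi> \<Longrightarrow> |H| <o r \<Longrightarrow> \<exists>\<eta>\<in>underS X.s \<xi>. \<forall>h\<in>H. X.ole h \<eta>"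
  shows "f \<in> net_lim r X Y (Meas_below \<xi>)"
proof -
  obtain P v where P1: "\<And>a k. a \<in> Field r \<Longrightarrow> k \<in> Field r \<Longrightarrow> X.Pi0 \<xi> (P a k)"
    and P2: "\<And>a x. a \<in> Field r \<Longrightarrow> x \<in> topspace X \<Longrightarrow> \<exists>k\<in>Field r. x \<in> P a k"
    and P3: "\<And>a k x. a \<in> Field r \<Longrightarrow> k \<in> Field r \<Longrightarrow> x \<in> P a k \<Longrightarrow> F a (v a k) (f x)"
    using Meas_Pi0_covers[OF f o ne] by blast
  have "\<exists>R lev. P a k = topspace X \<inter> (\<Inter>j\<in>Field r. R j) \<and>
    (\<forall>j\<in>Field r. lev j \<in> underS X.s \<xi> \<and> X.Delta (osuc X.s (lev j)) (\<lambda>x. x \<in> R j))"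
    if ak: "a \<in> Field r" "k \<in> Field r" for a k
  proof -
    obtain R where R: "P a k = topspace X \<inter> (\<Inter>j\<in>Field r. R j)"
      "\<And>j. j \<in> Field r \<Longrightarrow> \<exists>\<eta>. X.oless \<eta> \<xi> \<and> X.Delta (osuc X.s \<eta>) (\<lambda>x. x \<in> R j)"
      using X.Pi0_eq_INT_Delta[OF P1[OF ak]] by blast
    from R(2) have "\<forall>j\<in>Field r. \<exists>\<eta>. X.oless \<eta> \<xi> \<and> X.Delta (osuc X.s \<eta>) (\<lambda>x. x \<in> R j)" by blast
    from bchoice[OF this] show ?thesis using R(1) by blast
  qed
  then obtain R lev where
    R0: "\<And>a k. a \<in> Field r \<Longrightarrow> k \<in> Field r \<Longrightarrow> P a k = topspace X \<inter> (\<Inter>j\<in>Field r. R a k j)" and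
    L0: "\<And>a k. a \<in> Field r \<Longrightarrow> k \<in> Field r \<Longrightarrow>
      \<forall>j\<in>Field r. lev a k j \<in> underS X.s \<xi> \<and> X.Delta (osuc X.s (lev a k j)) (\<lambda>x. x \<in> R a k j)"
    by metis
  have uF: "underS r c \<subseteq> Field r" "under r c \<subseteq> Field r" for c
    unfolding underS_def under_def Field_def by auto
  define K where "K \<gamma> = underS r \<gamma> \<times> underS r \<gamma> \<times> underS r \<gamma>" for \<gamma>
  have Ks: "|K \<gamma>| <o r" for \<gamma>
    unfolding K_def by (intro X.Sigma_small X.underS_small)
  \<comment> \<open>\<open>T\<close> is a set of triples answered positively, and \<open>q\<close>
    collects the \<open>k\<close> that it does not refute. For an unsuitable \<open>T\<close> this
    may be empty; \<open>minim\<close> then gives an unspecified index, and the coherence condition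
    in \<open>B\<close> absorbs it.\<close>
  define q where "q \<gamma> T a = {k \<in> underS r \<gamma>. \<forall>j\<in>underS r \<gamma>. (a, k, j) \<in> T}" for \<gamma> T and a :: 'l
  define z where "z \<gamma> T a = v a (wo_rel.minim r (q \<gamma> T a))" for \<gamma> T a
  \<comment> \<open>Early guesses need not be coherent. Only indices whose guess agrees with all
    earlier ones are kept, so \<open>spherical\<close> applies for every \<open>T\<close>; the
    instance \<open>b = a\<close> forces the guess into the space.\<close>
  define B where "B \<gamma> T = {a \<in> underS r \<gamma>. \<forall>b\<in>under r a. F b (z \<gamma> T b) (z \<gamma> T a)}" for \<gamma> T
  have "\<exists>y. y \<in> topspace Y \<and> (\<forall>a\<in>B \<gamma> T. F a (z \<gamma> T a) y)" for \<gamma> T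
  proof (cases "B \<gamma> T = {}")
    case True
    then show ?thesis unfolding True using ne by blast
  next
    case False
    have "\<exists>y. \<forall>a\<in>B \<gamma> T. F a (z \<gamma> T a) y"
    proof (rule spherical[OF _ False])
      show "B \<gamma> T \<subseteq> Field r" unfolding B_def using uF by blast
      fix a b assume "a \<in> B \<gamma> T" "b \<in> B \<gamma> T" "(a, b) \<in> r"
      then show "F a (z \<gamma> T a) (z \<gamma> T b)" unfolding B_def under_def by blast
    qed
    then obtain y where "\<forall>a\<in>B \<gamma> T. F a (z \<gamma> T a) y" ..
    then show ?thesis using Y.E_in False by blast
  qed
  then obtain y where y: "\<And>\<gamma> T. y \<gamma> T \<in> topspace Y" "\<And>\<gamma> T a. a \<in> B \<gamma> T \<Longrightarrow> F a (z \<gamma> T a) (y \<gamma> T)"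
    by metis
  define S where "S \<gamma> x = {(a, k, j) \<in> K \<gamma>. x \<in> R a k j}" for \<gamma> x
  define g where "g \<gamma> = restrict (\<lambda>x. y \<gamma> (S \<gamma> x)) (topspace X)" for \<gamma>
  have gM: "g \<gamma> \<in> Meas_below \<xi>" for \<gamma>
  proof -
    \<comment> \<open>The levels of all sets consulted at stage \<gamma>. Their bound below \<xi> is
      what may be missing when \<xi> has small cofinality.\<close>
    let ?H = "(\<lambda>(a, k, j). lev a k j) ` K \<gamma>"
    have "?H \<subseteq> underS X.s \<xi>"
    proof
      fix h assume "h \<in> ?H"
      then obtain a k j where "(a, k, j) \<in> K \<gamma>" and h: "h = lev a k j" by auto
      then have "a \<in> Field r" "k \<in> Field r" "j \<in> Field r" using uF unfolding K_def by blast+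
      then show "h \<in> underS X.s \<xi>" using L0 h by blast
    qed
    from bdd[OF this X.image_small[OF Ks]] obtain \<eta> where \<eta>: "\<eta> \<in> underS X.s \<xi>" "\<forall>h\<in>?H. X.ole h \<eta>" ..
    have \<eta>F: "\<eta> \<in> Field X.s" using X.oless_Field(1)[OF \<eta>(1)] .
    have D: "X.Delta (osuc X.s \<eta>) (\<lambda>x. x \<in> R a k j)" if p: "(a, k, j) \<in> K \<gamma>" for a k j
    proof -
      have "a \<in> Field r" "k \<in> Field r" "j \<in> Field r" using p uF unfolding K_def by blast+
      then have "X.Delta (osuc X.s (lev a k j)) (\<lambda>x. x \<in> R a k j)" using L0 by blast
      moreover have "X.ole (lev a k j) \<eta>" using \<eta>(2) p by force
      ultimately show ?thesis using X.Delta_mono X.osuc_mono by blast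
    qed
    have piece: "X.Sig (osuc X.s \<eta>) {x \<in> topspace X. S \<gamma> x = T}" if T: "T \<in> Pow (K \<gamma>)" for T
    proof -
      have "X.Delta (osuc X.s \<eta>) (\<lambda>x. \<forall>p\<in>K \<gamma>. (case p of (a, k, j) \<Rightarrow> x \<in> R a k j) \<longleftrightarrow> p \<in> T)"
      proof (rule X.Delta_Ball[OF \<eta>F Ks], rule X.Delta_iff_const)
        fix p assume "p \<in> K \<gamma>"
        then show "X.Delta (osuc X.s \<eta>) (\<lambda>x. case p of (a, k, j) \<Rightarrow> x \<in> R a k j)"
          using D by (cases p) auto
      qed
      moreover have "(\<forall>p\<in>K \<gamma>. (case p of (a, k, j) \<Rightarrow> x \<in> R a k j) \<longleftrightarrow> p \<in> T) \<longleftrightarrow> S \<gamma> x = T" for x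
        using T unfolding S_def by auto
      ultimately show ?thesis unfolding X.Delta_def by simp
    qed
    have "g \<gamma> \<in> Meas (osuc X.s \<eta>)" unfolding measurable_fun_def
    proof (intro CollectI conjI allI impI)
      show "g \<gamma> \<in> topspace X \<rightarrow>\<^sub>E topspace Y" unfolding g_def using y(1) by auto
      fix U assume "openin Y U"
      let ?J = "{T \<in> Pow (K \<gamma>). y \<gamma> T \<in> U}"
      have J: "|?J| \<le>o r" by (rule X.subset_le[OF X.Pow_small_le[OF Ks]]) blast
      have "S \<gamma> x \<in> Pow (K \<gamma>)" for x unfolding S_def by auto
      then have "{x \<in> topspace X. g \<gamma> x \<in> U} = (\<Union>T\<in>?J. {x \<in> topspace X. S \<gamma> x = T})"
        unfolding g_def by auto
      moreover have "X.Sig (osuc X.s \<eta>) (\<Union>T\<in>?J. {x \<in> topspace X. S \<gamma> x = T})"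
        by (rule X.Sig_UN[OF J _ X.one_le_osuc[OF \<eta>F]], rule piece) blast
      ultimately show "X.Sig (osuc X.s \<eta>) {x \<in> topspace X. g \<gamma> x \<in> U}" by simp
    qed
    then show ?thesis using \<eta>(1) by blast
  qed
  have conv: "\<exists>d0\<in>Field r. \<forall>d. (d0, d) \<in> r \<longrightarrow> g d x \<in> U"
    if x: "x \<in> topspace X" and U: "openin Y U" "f x \<in> U" for x U
  proof -
    obtain a0 where a0: "a0 \<in> Field r" "\<And>y. F a0 (f x) y \<Longrightarrow> y \<in> U"
      using U unfolding Y.open_iff by blast
    define ks where "ks a = wo_rel.minim r {k \<in> Field r. x \<in> P a k}" for a
    have ks: "ks a \<in> Field r" "x \<in> P a (ks a)" if "a \<in> Field r" for a
      using wo_rel.minim_in[OF X.wo, of "{k \<in> Field r. x \<in> P a k}"] P2[OF that x]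
      unfolding ks_def by blast+
    have "\<exists>j. j \<in> Field r \<and> x \<notin> R a k j" if a: "a \<in> Field r" and k: "k \<in> underS r (ks a)" for a k
    proof -
      have kF: "k \<in> Field r" using k uF by blast
      have "x \<notin> P a k"
      proof
        assume "x \<in> P a k"
        then have "(ks a, k) \<in> r"
          unfolding ks_def using kF by (intro wo_rel.minim_least[OF X.wo]) auto
        then show False using k wo_rel.ANTISYM[OF X.wo] unfolding underS_def antisym_def by blast
      qed
      then show ?thesis using R0[OF a kF] x by blast
    qed
    then obtain jj where jj: "\<And>a k. a \<in> Field r \<Longrightarrow> k \<in> underS r (ks a) \<Longrightarrow> jj a k \<in> Field r \<and> x \<notin> R a k (jj a k)"
      by metis
    \<comment> \<open>From stage \<open>b a\<close> on the guess at \<open>a\<close> is right: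
      \<open>a\<close>, the correct index \<open>ks a\<close> and a refutation of each smaller index
      have all been seen.\<close>
    have "\<exists>b. b \<in> Field r \<and> insert a (insert (ks a) (jj a ` underS r (ks a))) \<subseteq> underS r b"
      if a: "a \<in> Field r" for a
    proof -
      have "insert a (insert (ks a) (jj a ` underS r (ks a))) \<subseteq> Field r"
        using a ks(1)[OF a] jj[OF a] by blast
      moreover have "|insert a (insert (ks a) (jj a ` underS r (ks a)))| <o r"
        by (intro X.insert_small X.image_small X.underS_small)
      ultimately show ?thesis by (rule X.small_strictly_bounded) blast
    qed
    then obtain b where b: "\<And>a. a \<in> Field r \<Longrightarrow> b a \<in> Field r"
      "\<And>a. a \<in> Field r \<Longrightarrow> insert a (insert (ks a) (jj a ` underS r (ks a))) \<subseteq> underS r (b a)"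
      by metis
    \<comment> \<open>The guesses at all indices up to \<open>a0\<close> must be right at once,
      since \<open>B\<close> tests \<open>a0\<close> against every earlier one; regularity is used a
      second time.\<close>
    have "b ` under r a0 \<subseteq> Field r" using b(1) uF(2) by blast
    then obtain c where c: "c \<in> Field r" "b ` under r a0 \<subseteq> underS r c"
      by (rule X.small_strictly_bounded[OF _ X.image_small[OF X.under_small]])
    have "g d x \<in> U" if d: "(c, d) \<in> r" for d
    proof -
      have lt: "h \<in> underS r d" if "a \<in> under r a0" "h \<in> underS r (b a)" for a h
      proof -
        have "b a \<in> underS r c" using c(2) that(1) by blast
        then have "(h, b a) \<in> r" "h \<noteq> b a" "(b a, d) \<in> r"
          using that(2) d wo_rel.TRANS[OF X.wo] unfolding underS_def trans_def by blast+
        then show ?thesis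
          using wo_rel.TRANS[OF X.wo] wo_rel.ANTISYM[OF X.wo] unfolding underS_def trans_def antisym_def
          by blast
      qed
      have m: "wo_rel.minim r (q d (S d x) a) = ks a" and aF: "a \<in> underS r d" if a: "a \<in> under r a0" for a
      proof -
        have aFr: "a \<in> Field r" using a uF by blast
        show ad: "a \<in> underS r d" using lt[OF a] b(2)[OF aFr] by blast
        have kd: "ks a \<in> underS r d" using lt[OF a] b(2)[OF aFr] by blast
        show "wo_rel.minim r (q d (S d x) a) = ks a"
        proof (rule sym, rule wo_rel.equals_minim[OF X.wo])
          show "q d (S d x) a \<subseteq> Field r" unfolding q_def using uF by blast
          have "x \<in> R a (ks a) j" if "j \<in> Field r" for j
            using R0[OF aFr ks(1)[OF aFr]] ks(2)[OF aFr] that by blast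
          then show "ks a \<in> q d (S d x) a" unfolding q_def S_def K_def using ad kd uF by blast
          fix k assume k: "k \<in> q d (S d x) a"
          have kF: "k \<in> Field r" using k uF unfolding q_def by blast
          have "k \<notin> underS r (ks a)"
          proof
            assume ku: "k \<in> underS r (ks a)"
            then have "jj a k \<in> underS r d" using lt[OF a] b(2)[OF aFr] by blast
            then have "x \<in> R a k (jj a k)" using k unfolding q_def S_def by blast
            then show False using jj[OF aFr ku] by blast
          qed
          then show "(ks a, k) \<in> r"
            using wo_rel.TOTALS[OF X.wo] kF ks(1)[OF aFr] unfolding underS_def by blast
        qed
      qed
      have zf: "F a (z d (S d x) a) (f x)" if a: "a \<in> under r a0" for a
      proof -
        have aFr: "a \<in> Field r" using a uF by blast
        show ?thesis unfolding z_def m[OF a] by (rule P3[OF aFr ks[OF aFr]])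
      qed
      have a0u: "a0 \<in> under r a0"
        using wo_rel.REFL[OF X.wo] a0(1) unfolding under_def refl_on_def by blast
      \<comment> \<open>Correct guesses all contain \<open>f x\<close> in their classes, hence they
        are coherent.\<close>
      have "a0 \<in> B d (S d x)" unfolding B_def
      proof (intro CollectI conjI ballI aF[OF a0u])
        fix b assume bu: "b \<in> under r a0"
        then have "F b (z d (S d x) a0) (f x)" using Y.E_mono zf[OF a0u] unfolding under_def by blast
        then show "F b (z d (S d x) b) (z d (S d x) a0)" using zf[OF bu] Y.E_trans Y.E_sym by blast
      qed
      then have "F a0 (f x) (y d (S d x))" using y(2) zf[OF a0u] Y.E_trans Y.E_sym by blast
      then show ?thesis using a0(2) x unfolding g_def by simp
    qed
    then show ?thesis using c(1) by blast
  qed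
  show ?thesis unfolding net_lim_def
  proof (intro CollectI conjI)
    show "f \<in> topspace X \<rightarrow>\<^sub>E topspace Y" by (rule Meas_funcset[OF f])
    show "\<exists>g. (\<forall>d\<in>Field r. g d \<in> Meas_below \<xi>) \<and> (\<forall>x\<in>topspace X. \<forall>U. openin Y U \<and> f x \<in> U \<longrightarrow>
               (\<exists>d0\<in>Field r. \<forall>d. (d0, d) \<in> r \<longrightarrow> g d x \<in> U))"
      by (rule exI[of _ g]) (use gM conv in simp)
  qed
qed

end

section \<open>Finite systems of constraints at limits of small cofinality\<close>

lemma finite_upper_bound:
  assumes "Well_order D" "finite H" "H \<subseteq> Field D" "Field D \<noteq> {}"
  shows "\<exists>e\<in>Field D. \<forall>h\<in>H. (h, e) \<in> D"
  using assms(2,3)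
proof (induction H rule: finite_induct)
  case empty
  then show ?case using assms(4) by auto
next
  case (insert h H)
  have wo: "wo_rel D" using assms(1) unfolding wo_rel_def .
  obtain e where e: "e \<in> Field D" "\<forall>h\<in>H. (h, e) \<in> D" using insert by blast
  have h: "h \<in> Field D" using insert by blast
  show ?case
  proof (cases "(h, e) \<in> D")
    case True
    then show ?thesis using e by blast
  next
    case False
    then have "(e, h) \<in> D" using wo_rel.TOTALS[OF wo] e(1) h by blast
    moreover have "(h, h) \<in> D" using wo_rel.REFL[OF wo] h unfolding refl_on_def by blast
    ultimately show ?thesis
      using e(2) h wo_rel.TRANS[OF wo] unfolding trans_def by (intro bexI[of _ h]) blast+
  qed
qed

context nested_pair
begin

text \<open>Refutations of \<open>x \<in> P t\<close> accumulate along \<open>D\<close>. Freezing the value at the first stage at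
  which the unrefuted constraints become satisfiable makes the stages at which the limit is
  attained \<open>\<Delta>\<close> below \<open>\<xi>\<close>.\<close>

lemma finite_constraints_hat_lim:
  fixes D :: "'l set rel"
  assumes lim: "is_olim X.s \<xi>" and D: "Well_order D" "Field D \<noteq> {}" "|Field D| <o r"
    and cof: "\<And>\<eta>. \<eta> \<in> underS X.s \<xi> \<Longrightarrow> \<exists>d\<in>Field D. X.ole \<eta> d"
    and bdd: "\<And>d. d \<in> Field D \<Longrightarrow> \<exists>\<zeta>\<in>underS X.s \<xi>. \<forall>d'\<in>under D d. X.ole d' \<zeta>"
    and T: "finite T" "\<And>t. t \<in> T \<Longrightarrow> X.Pi0 \<xi> (P t)"
    and f: "\<And>x. x \<in> topspace X \<Longrightarrow> f x \<in> topspace Y"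
      "\<And>t x. t \<in> T \<Longrightarrow> x \<in> P t \<Longrightarrow> f x \<in> V t"
    and ne: "topspace Y \<noteq> {}"
  shows "\<exists>g\<in>hat_lim r \<xi> D X Y (Meas_below \<xi>). \<forall>t\<in>T. \<forall>x\<in>P t. g x \<in> V t"
proof -
  obtain y0 where y0: "y0 \<in> topspace Y" using ne by blast
  have wo: "wo_rel D" using D(1) unfolding wo_rel_def .
  have Dtr: "(a, c) \<in> D" if "(a, b) \<in> D" "(b, c) \<in> D" for a b c
    using that wo_rel.TRANS[OF wo] unfolding trans_def by blast
  have Das: "a = b" if "(a, b) \<in> D" "(b, a) \<in> D" for a b
    using that wo_rel.ANTISYM[OF wo] unfolding antisym_def by blast
  have Drefl: "(a, a) \<in> D" if "a \<in> Field D" for a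
    using that wo_rel.REFL[OF wo] unfolding refl_on_def by blast
  have DF: "a \<in> Field D" "b \<in> Field D" if "(a, b) \<in> D" for a b
    using that unfolding Field_def by blast+
  have \<xi>: "\<xi> \<in> Field X.s" "\<xi> \<noteq> ozero X.s" "\<xi> \<noteq> X.one"
    using lim X.ozero_Field unfolding is_olim_def is_osuc_def by blast+
  have o1: "X.oless X.one \<xi>"
    using X.one_le[OF \<xi>(1,2)] \<xi>(3) X.ole_iff_oless_or_eq by blast
  have "\<exists>A dd. (\<forall>j\<in>Field r. dd j \<in> Field D \<and> X.Pi0 (dd j) (A j)) \<and> topspace X - P t = (\<Union>j\<in>Field r. A j)"
    if t: "t \<in> T" for t
  proof -
    obtain A where A: "\<And>j. j \<in> Field r \<Longrightarrow> \<exists>\<eta>. X.oless \<eta> \<xi> \<and> X.Pi0 \<eta> (A j)"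
      "topspace X - P t = (\<Union>j\<in>Field r. A j)"
      using X.Sig_enum[OF _ o1, of "topspace X - P t"] T(2)[OF t] unfolding X.Pi0_def by blast
    have "\<forall>j\<in>Field r. \<exists>d. d \<in> Field D \<and> X.Pi0 d (A j)"
    proof
      fix j assume "j \<in> Field r"
      then obtain \<eta> where \<eta>: "X.oless \<eta> \<xi>" "X.Pi0 \<eta> (A j)" using A(1) by blast
      obtain d where "d \<in> Field D" "X.ole \<eta> d" using cof[OF \<eta>(1)] by blast
      then show "\<exists>d. d \<in> Field D \<and> X.Pi0 d (A j)" using X.Pi0_mono[OF \<eta>(2)] by blast
    qed
    from bchoice[OF this] show ?thesis using A(2) by blast
  qed
  then obtain A dd where
    A: "\<And>t. t \<in> T \<Longrightarrow> \<forall>j\<in>Field r. dd t j \<in> Field D \<and> X.Pi0 (dd t j) (A t j)"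
      "\<And>t. t \<in> T \<Longrightarrow> topspace X - P t = (\<Union>j\<in>Field r. A t j)"
    by metis
  \<comment> \<open>Elements of \<open>D\<close> are indices below \<xi> and serve both as stages
    and as levels, but \<open>D\<close> need not follow the order of the ordinals. The level of
    stage \<open>d\<close> is therefore a bound on all stages up to \<open>d\<close>.\<close>
  obtain \<zeta> where \<zeta>: "\<And>d. d \<in> Field D \<Longrightarrow> \<zeta> d \<in> underS X.s \<xi>"
    "\<And>d d'. d \<in> Field D \<Longrightarrow> d' \<in> under D d \<Longrightarrow> X.ole d' (\<zeta> d)"
    using bdd by metis
  \<comment> \<open>Pieces of level \<open>\<zeta> d\<close> have unions that are Sigma at
    \<open>lv d\<close> and ambiguous one level later; both successors stay below the limit
    \<xi>.\<close>
  define lv where "lv d = osuc X.s (\<zeta> d)" for d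
  have lv: "lv d \<in> underS X.s \<xi>" "\<zeta> d \<in> Field X.s" "lv d \<in> Field X.s" if "d \<in> Field D" for d
    using X.osuc_oless_olim[OF lim \<zeta>(1)[OF that]] X.oless_Field(1)[OF \<zeta>(1)[OF that]] X.osuc_Field
    unfolding lv_def by blast+
  \<comment> \<open>The part of the complement of \<open>P t\<close> that has been revealed by stage
    \<open>d\<close>.\<close>
  define N where "N t d = (\<Union>j\<in>{j \<in> Field r. (dd t j, d) \<in> D}. A t j)" for t d
  have N_mono: "N t d \<subseteq> N t e" if "(d, e) \<in> D" for t d e
    unfolding N_def using Dtr that by blast
  have NP: "x \<notin> P t" if "t \<in> T" "x \<in> N t d" for t x d
    using A(2)[OF that(1)] that(2) unfolding N_def by blast
  have DlN: "X.Delta (osuc X.s (lv e)) (\<lambda>x. x \<in> N t d)" if de: "(d, e) \<in> D" and t: "t \<in> T" for t d e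
  proof -
    have e: "e \<in> Field D" using DF de by blast
    have "X.Sig (lv e) (N t d)" unfolding N_def
    proof (rule X.Sig_UN)
      show "|{j \<in> Field r. (dd t j, d) \<in> D}| \<le>o r" by (rule X.subset_le[OF X.Field_le]) blast
      show "X.ole X.one (lv e)" unfolding lv_def by (rule X.one_le_osuc[OF lv(2)[OF e]])
      fix j assume j: "j \<in> {j \<in> Field r. (dd t j, d) \<in> D}"
      have "dd t j \<in> under D e" using Dtr[OF _ de] j unfolding under_def by blast
      then have "X.Pi0 (\<zeta> e) (A t j)" using \<zeta>(2)[OF e] A(1)[OF t] j X.Pi0_mono by blast
      then show "X.Sig (lv e) (A t j)"
        unfolding lv_def by (rule X.Pi0_imp_Sig[OF _ X.oless_osuc[OF lv(2)[OF e]]])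
    qed
    then show ?thesis by (rule X.Sig_imp_Delta[OF _ X.oless_osuc[OF lv(3)[OF e]]])
  qed
  define Tx where "Tx d x = {t \<in> T. x \<notin> N t d}" for d x
  have Tx_anti: "Tx e x \<subseteq> Tx d x" if "(d, e) \<in> D" for d e x
    unfolding Tx_def using N_mono[OF that] by blast
  define con where "con T' \<longleftrightarrow> (\<exists>y\<in>topspace Y. \<forall>t\<in>T'. y \<in> V t)" for T'
  define good where "good d x \<longleftrightarrow> con (Tx d x)" for d x
  have good_mono: "good e x" if "(d, e) \<in> D" "good d x" for d e x
    using that(2) Tx_anti[OF that(1)] unfolding good_def con_def by blast
  have DlT: "X.Delta (osuc X.s (lv e)) (\<lambda>x. Tx d x = T')" if de: "(d, e) \<in> D" and "T' \<subseteq> T" for d e T'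
  proof -
    have e: "e \<in> Field D" using DF de by blast
    have "X.Delta (osuc X.s (lv e)) (\<lambda>x. \<forall>t\<in>T. (x \<in> N t d) = (t \<notin> T'))"
      by (intro X.Delta_Ball[OF lv(3)[OF e] X.finite_small[OF T(1)]] X.Delta_iff_const DlN[OF de])
    moreover have "(\<lambda>x. \<forall>t\<in>T. (x \<in> N t d) = (t \<notin> T')) = (\<lambda>x. Tx d x = T')"
      using that(2) unfolding Tx_def by (intro ext) blast
    ultimately show ?thesis by simp
  qed
  have Dlgood: "X.Delta (osuc X.s (lv e)) (good d)" if de: "(d, e) \<in> D" for d e
  proof -
    have e: "e \<in> Field D" using DF de by blast
    have "X.Delta (osuc X.s (lv e)) (\<lambda>x. \<exists>T'\<in>{T' \<in> Pow T. con T'}. Tx d x = T')"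
      by (rule X.Delta_Bex[OF lv(3)[OF e] X.finite_small], use T(1) in simp, rule DlT[OF de]) blast
    moreover have "(\<lambda>x. \<exists>T'\<in>{T' \<in> Pow T. con T'}. Tx d x = T') = good d"
      unfolding good_def Tx_def by (intro ext) auto
    ultimately show ?thesis by simp
  qed
  define c where "c T' = (SOME y. y \<in> topspace Y \<and> (\<forall>t\<in>T'. y \<in> V t))" for T'
  have c: "c T' \<in> topspace Y" "\<And>t. t \<in> T' \<Longrightarrow> c T' \<in> V t" if "con T'" for T'
  proof -
    have "\<exists>y. y \<in> topspace Y \<and> (\<forall>t\<in>T'. y \<in> V t)" using that unfolding con_def by blast
    from someI_ex[OF this] show "c T' \<in> topspace Y" "\<And>t. t \<in> T' \<Longrightarrow> c T' \<in> V t"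
      unfolding c_def by blast+
  qed
  \<comment> \<open>The value is fixed at the first good stage: \<open>c (Tx d x)\<close> could
    change as further constraints are refuted, whereas \<open>hat_lim\<close> asks for equality at
    all later stages.\<close>
  define \<delta> where "\<delta> x = wo_rel.minim D {d \<in> Field D. good d x}" for x
  define G where "G x = c (Tx (\<delta> x) x)" for x
  have ex_good: "\<exists>d\<in>Field D. good d x" if x: "x \<in> topspace X" for x
  proof -
    have "\<forall>t\<in>T. \<exists>d. d \<in> Field D \<and> (x \<notin> P t \<longrightarrow> x \<in> N t d)"
    proof
      fix t assume t: "t \<in> T"
      show "\<exists>d. d \<in> Field D \<and> (x \<notin> P t \<longrightarrow> x \<in> N t d)"
      proof (cases "x \<in> P t")
        case True
        then show ?thesis using D(2) by blast
      next
        case False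
        then obtain j where j: "j \<in> Field r" "x \<in> A t j" using A(2)[OF t] x by blast
        then have "dd t j \<in> Field D" using A(1)[OF t] by blast
        then show ?thesis using j Drefl unfolding N_def by blast
      qed
    qed
    from bchoice[OF this] obtain h where h: "\<forall>t\<in>T. h t \<in> Field D \<and> (x \<notin> P t \<longrightarrow> x \<in> N t (h t))" ..
    \<comment> \<open>By stage \<open>e\<close> each of the finitely many constraints that do not
      apply to \<open>x\<close> is refuted, and \<open>f x\<close> satisfies the remaining
      ones.\<close>
    obtain e where e: "e \<in> Field D" "\<forall>u\<in>h ` T. (u, e) \<in> D"
      using finite_upper_bound[OF D(1), of "h ` T"] T(1) h D(2) by blast
    have "f x \<in> V t" if "t \<in> Tx e x" for t
    proof -
      have t: "t \<in> T" "x \<notin> N t e" using that unfolding Tx_def by blast+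
      have "x \<notin> N t (h t)" using t N_mono e(2) by blast
      then have "x \<in> P t" using h t(1) by blast
      then show ?thesis using f(2) t(1) by blast
    qed
    then have "good e x" unfolding good_def con_def using f(1)[OF x] by blast
    then show ?thesis using e(1) by blast
  qed
  have \<delta>: "\<delta> x \<in> Field D" "good (\<delta> x) x" "\<And>d. d \<in> Field D \<Longrightarrow> good d x \<Longrightarrow> (\<delta> x, d) \<in> D"
    if x: "x \<in> topspace X" for x
  proof -
    have "\<delta> x \<in> {d \<in> Field D. good d x}"
      unfolding \<delta>_def using ex_good[OF x] by (intro wo_rel.minim_in[OF wo]) auto
    then show "\<delta> x \<in> Field D" "good (\<delta> x) x" by blast+
    show "(\<delta> x, d) \<in> D" if "d \<in> Field D" "good d x" for d
      unfolding \<delta>_def using that by (intro wo_rel.minim_least[OF wo]) auto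
  qed
  have GY: "G x \<in> topspace Y" if "x \<in> topspace X" for x
    unfolding G_def using c(1) \<delta>(2)[OF that] unfolding good_def by blast
  define g where "g d = restrict (\<lambda>x. if good d x then G x else y0) (topspace X)" for d
  have gM: "g d \<in> Meas_below \<xi>" if d: "d \<in> Field D" for d
  proof -
    let ?\<eta> = "osuc X.s (lv d)"
    note F = lv(3)[OF d]
    have o: "X.ole X.one ?\<eta>" by (rule X.one_le_osuc[OF F])
    have us: "|under D d| <o r" "|underS D d'| <o r" for d'
      by (rule X.subset_small[OF D(3)], force simp: under_def underS_def Field_def)+
    have "g d \<in> Meas ?\<eta>" unfolding measurable_fun_def
    proof (intro CollectI conjI allI impI)
      show "g d \<in> topspace X \<rightarrow>\<^sub>E topspace Y" unfolding g_def using GY y0 by auto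
      fix U assume "openin Y U"
      \<comment> \<open>Spells out which stage is the first good one and which constraints are left
        there. Only stages up to \<open>d\<close> are inspected, fewer than \<lambda> of them, so
        everything is ambiguous at one level.\<close>
      define \<phi> where "\<phi> x \<longleftrightarrow> (\<exists>d'\<in>under D d. \<exists>T'\<in>{T' \<in> Pow T. c T' \<in> U}.
        (good d' x \<and> Tx d' x = T') \<and> (\<forall>e\<in>underS D d'. \<not> good e x))" for x
      have \<phi>: "\<phi> x \<longleftrightarrow> good d x \<and> G x \<in> U" if x: "x \<in> topspace X" for x
      proof
        assume "\<phi> x"
        then obtain d' T' where d': "(d', d) \<in> D" "c T' \<in> U" "good d' x" "Tx d' x = T'"
          "\<And>e. e \<in> underS D d' \<Longrightarrow> \<not> good e x"
          unfolding \<phi>_def under_def by blast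
        have "(\<delta> x, d') \<in> D" using \<delta>(3)[OF x] d'(3) DF(1)[OF d'(1)] by blast
        then have "\<delta> x = d'" using d'(5)[of "\<delta> x"] \<delta>(2)[OF x] unfolding underS_def by blast
        then show "good d x \<and> G x \<in> U" unfolding G_def using d' good_mono by auto
      next
        assume a: "good d x \<and> G x \<in> U"
        have "\<delta> x \<in> under D d" using \<delta>(3)[OF x d] a unfolding under_def by blast
        moreover have "\<not> good e x" if "e \<in> underS D (\<delta> x)" for e
          using that \<delta>(3)[OF x] DF Das unfolding underS_def by blast
        moreover have "Tx (\<delta> x) x \<in> {T' \<in> Pow T. c T' \<in> U}"
          using a unfolding G_def Tx_def by blast
        ultimately show "\<phi> x" unfolding \<phi>_def using \<delta>(2)[OF x] by blast
      qed
      have Tc: "|{T' \<in> Pow T. c T' \<in> U}| <o r" by (rule X.finite_small) (use T(1) in simp)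
      have D\<phi>: "X.Delta ?\<eta> \<phi>" unfolding \<phi>_def
      proof (intro X.Delta_Bex[OF F] X.Delta_conj[OF F] X.Delta_Ball[OF F] X.Delta_not us Tc)
        fix d' T' assume d': "d' \<in> under D d" and T': "T' \<in> {T' \<in> Pow T. c T' \<in> U}"
        have dd: "(d', d) \<in> D" using d' unfolding under_def by blast
        show "X.Delta ?\<eta> (good d')" by (rule Dlgood[OF dd])
        show "X.Delta ?\<eta> (\<lambda>x. Tx d' x = T')" by (rule DlT[OF dd]) (use T' in blast)
        fix e assume "e \<in> underS D d'"
        then have "(e, d) \<in> D" using Dtr dd unfolding underS_def by blast
        then show "X.Delta ?\<eta> (good e)" by (rule Dlgood)
      qed
      have "X.Delta ?\<eta> (\<lambda>x. \<phi> x \<or> (\<not> good d x \<and> y0 \<in> U))"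
        by (intro X.Delta_disj[OF F] X.Delta_conj[OF F] X.Delta_not X.Delta_const o D\<phi> Dlgood Drefl d)
      moreover have "{x \<in> topspace X. g d x \<in> U} = {x \<in> topspace X. \<phi> x \<or> (\<not> good d x \<and> y0 \<in> U)}"
        using \<phi> unfolding g_def by auto
      ultimately show "X.Sig ?\<eta> {x \<in> topspace X. g d x \<in> U}" unfolding X.Delta_def by simp
    qed
    then show ?thesis using lv(1)[OF d] by blast
  qed
  define C where "C d = {x \<in> topspace X. good d x}" for d
  have "restrict G (topspace X) \<in> hat_lim r \<xi> D X Y (Meas_below \<xi>)"
    unfolding hat_lim_def
  proof (intro CollectI conjI exI)
    show "restrict G (topspace X) \<in> topspace X \<rightarrow>\<^sub>E topspace Y" using GY by auto
    show "\<forall>d\<in>Field D. g d \<in> Meas_below \<xi>" using gM by blast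
    show "(\<Union>d\<in>Field D. C d) = topspace X" using ex_good unfolding C_def by blast
    show "\<forall>d\<in>Field D. X.Sig \<xi> (C d)"
    proof
      fix d assume d: "d \<in> Field D"
      have "X.Sig (osuc X.s (lv d)) (C d)"
        using Dlgood[OF Drefl[OF d]] unfolding X.Delta_def C_def by blast
      then show "X.Sig \<xi> (C d)" by (rule X.Sig_mono[OF _ X.osuc_least[OF lv(1)[OF d]]])
    qed
    show "\<forall>(d, d')\<in>D. C d \<subseteq> C d'" using good_mono unfolding C_def by blast
    show "\<forall>(d, d')\<in>D. \<forall>x\<in>C d. g d' x = restrict G (topspace X) x"
      using good_mono unfolding C_def g_def by auto
  qed
  moreover have "restrict G (topspace X) x \<in> V t" if t: "t \<in> T" and x: "x \<in> P t" for t x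
  proof -
    have xX: "x \<in> topspace X" using T(2)[OF t] x unfolding X.Pi0_def by blast
    have "t \<in> Tx (\<delta> x) x" unfolding Tx_def using NP[OF t] x t by blast
    then have "G x \<in> V t" unfolding G_def using c(2) \<delta>(2)[OF xX] unfolding good_def by blast
    then show ?thesis using xX by simp
  qed
  ultimately show ?thesis by blast
qed

end

section \<open>Directed sets and cofinalities\<close>

lemma net_lim_mono: "\<F> \<subseteq> \<G> \<Longrightarrow> net_lim D X Y \<F> \<subseteq> net_lim D X Y \<G>"
  unfolding net_lim_def by blast

lemma net_lim_const:
  assumes "f \<in> \<F>" "f \<in> topspace X \<rightarrow>\<^sub>E topspace Y" "Field D \<noteq> {}"
  shows "f \<in> net_lim D X Y \<F>"
  unfolding net_lim_def using assms by (intro CollectI conjI exI[of _ "\<lambda>_. f"]) auto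

lemma directed_dir_image:
  assumes "directed_rel D" "inj_on h (Field D)"
  shows "directed_rel (dir_image D h)"
proof -
  have "Preorder (dir_image D h)"
    using assms Preorder_dir_image unfolding directed_rel_def by blast
  moreover have "\<exists>c\<in>h ` Field D. (x, c) \<in> dir_image D h \<and> (y, c) \<in> dir_image D h"
    if xy: "x \<in> h ` Field D" "y \<in> h ` Field D" for x y
  proof -
    obtain a b where ab: "x = h a" "y = h b" "a \<in> Field D" "b \<in> Field D" using xy by blast
    then obtain c where "c \<in> Field D" "(a, c) \<in> D" "(b, c) \<in> D"
      using assms(1) unfolding directed_rel_def by blast
    then show ?thesis using ab unfolding dir_image_def by blast
  qed
  moreover have "Field D \<noteq> {}" using assms(1) unfolding directed_rel_def by blast
  ultimately show ?thesis unfolding directed_rel_def by (simp add: dir_image_Field)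
qed

text \<open>\<open>small_directed r\<close> contains only relations on the type of \<open>r\<close>,
  while \<open>fin_dir r\<close> and \<open>ocof\<close> live on sets. They enter the second
  hierarchy as copies under an injection.\<close>

lemma net_lim_dir_image:
  assumes "inj_on h (Field D)"
  shows "net_lim D X Y \<F> \<subseteq> net_lim (dir_image D h) X Y \<F>"
proof
  fix f assume "f \<in> net_lim D X Y \<F>"
  then obtain g where f: "f \<in> topspace X \<rightarrow>\<^sub>E topspace Y" and g: "\<forall>d\<in>Field D. g d \<in> \<F>"
    and conv: "\<forall>x\<in>topspace X. \<forall>U. openin Y U \<and> f x \<in> U \<longrightarrow>
      (\<exists>d0\<in>Field D. \<forall>d. (d0, d) \<in> D \<longrightarrow> g d x \<in> U)"
    unfolding net_lim_def by blast
  have DF: "a \<in> Field D" "b \<in> Field D" if "(a, b) \<in> D" for a b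
    using that unfolding Field_def by blast+
  define k where "k d = g (inv_into (Field D) h d)" for d
  have k: "k (h d) = g d" if "d \<in> Field D" for d
    unfolding k_def using assms that by simp
  show "f \<in> net_lim (dir_image D h) X Y \<F>" unfolding net_lim_def dir_image_Field
  proof (intro CollectI conjI f exI[of _ k] ballI allI impI)
    fix d assume "d \<in> h ` Field D"
    then show "k d \<in> \<F>" using k g by auto
  next
    fix x U assume x: "x \<in> topspace X" "openin Y U \<and> f x \<in> U"
    obtain d0 where d0: "d0 \<in> Field D" "\<forall>d. (d0, d) \<in> D \<longrightarrow> g d x \<in> U"
      using bspec[OF conv x(1)] x(2) by blast
    have "k d x \<in> U" if d: "(h d0, d) \<in> dir_image D h" for d
    proof -
      obtain a b where ab: "h d0 = h a" "d = h b" "(a, b) \<in> D" using d unfolding dir_image_def by blast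
      have "d0 = a" using ab d0(1) DF by (intro inj_onD[OF assms]) auto
      then show ?thesis using d0(2) ab k[OF DF(2)[OF ab(3)]] by simp
    qed
    then show "\<exists>d0\<in>h ` Field D. \<forall>d. (d0, d) \<in> dir_image D h \<longrightarrow> k d x \<in> U" using d0(1) by blast
  qed
qed

lemma hat_lim_dir_image:
  assumes "inj_on h (Field D)"
  shows "hat_lim r \<xi> D X Y \<F> \<subseteq> hat_lim r \<xi> (dir_image D h) X Y \<F>"
proof
  fix f assume "f \<in> hat_lim r \<xi> D X Y \<F>"
  then obtain g C where f: "f \<in> topspace X \<rightarrow>\<^sub>E topspace Y" and g: "\<forall>d\<in>Field D. g d \<in> \<F>"
    and C: "(\<Union>d\<in>Field D. C d) = topspace X" "\<forall>d\<in>Field D. sigma0 r X \<xi> (C d)"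
    "\<forall>(d, d')\<in>D. C d \<subseteq> C d'" "\<forall>(d, d')\<in>D. \<forall>x\<in>C d. g d' x = f x"
    unfolding hat_lim_def by blast
  have DF: "a \<in> Field D" "b \<in> Field D" if "(a, b) \<in> D" for a b
    using that unfolding Field_def by blast+
  let ?i = "inv_into (Field D) h"
  have i: "?i (h d) = d" if "d \<in> Field D" for d using assms that by simp
  have im: "\<exists>a b. d = h a \<and> d' = h b \<and> (a, b) \<in> D \<and> ?i d = a \<and> ?i d' = b" if "(d, d') \<in> dir_image D h" for d d'
    using that i DF unfolding dir_image_def by blast
  show "f \<in> hat_lim r \<xi> (dir_image D h) X Y \<F>" unfolding hat_lim_def dir_image_Field
  proof (intro CollectI conjI f exI[of _ "\<lambda>d. g (?i d)"] exI[of _ "\<lambda>d. C (?i d)"])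
    show "\<forall>d\<in>h ` Field D. g (?i d) \<in> \<F>" using g i by simp
    show "(\<Union>d\<in>h ` Field D. C (?i d)) = topspace X" using C(1) i by simp
    show "\<forall>d\<in>h ` Field D. sigma0 r X \<xi> (C (?i d))" using C(2) i by simp
    show "\<forall>(d, d')\<in>dir_image D h. C (?i d) \<subseteq> C (?i d')" using C(3) im by fastforce
    show "\<forall>(d, d')\<in>dir_image D h. \<forall>x\<in>C (?i d). g (?i d') x = f x" using C(4) im by fastforce
  qed
qed

lemma Well_order_directed:
  assumes "Well_order D" "Field D \<noteq> {}"
  shows "directed_rel D"
proof -
  have wo: "wo_rel D" using assms(1) unfolding wo_rel_def .
  have "Preorder D"
    using assms(1) unfolding well_order_on_def linear_order_on_def partial_order_on_def by blast
  moreover have "\<exists>c\<in>Field D. (a, c) \<in> D \<and> (b, c) \<in> D" if "a \<in> Field D" "b \<in> Field D" for a b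
    using wo_rel.TOTALS[OF wo] wo_rel.REFL[OF wo] that unfolding refl_on_def by blast
  ultimately show ?thesis unfolding directed_rel_def using assms(2) by blast
qed

section \<open>Size of the finite subsets and cofinal sets below a limit\<close>

context regular_cardinal
begin

lemma Field_fin_dir: "Field (fin_dir r) = {W. finite W \<and> W \<subseteq> Field r}"
  unfolding fin_dir_def Field_def by (auto intro: finite_subset)

lemma directed_fin_dir: "directed_rel (fin_dir r)"
proof -
  have "Preorder (fin_dir r)"
    unfolding preorder_on_def Field_fin_dir
    by (auto simp: fin_dir_def refl_on_def trans_def intro: finite_subset)
  moreover have "Field (fin_dir r) \<noteq> {}" unfolding Field_fin_dir by blast
  moreover have "\<exists>c\<in>Field (fin_dir r). (a, c) \<in> fin_dir r \<and> (b, c) \<in> fin_dir r"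
    if "a \<in> Field (fin_dir r)" "b \<in> Field (fin_dir r)" for a b
    using that unfolding Field_fin_dir unfolding fin_dir_def by (intro bexI[of _ "a \<union> b"]) auto
  ultimately show ?thesis unfolding directed_rel_def by blast
qed

text \<open>The sets of size \<open>n + 1\<close> are images of pairs of a point and a set of size
  \<open>n\<close>; countably many such layers are united.\<close>

lemma fin_dir_le: "|Field (fin_dir r)| \<le>o r"
proof -
  define L where "L n = {W. finite W \<and> W \<subseteq> Field r \<and> card W = n}" for n :: nat
  have L: "|L n| \<le>o r" for n
  proof (induction n)
    case 0
    have "L 0 = {{}}" unfolding L_def by auto
    then show ?case using finite_le[of "{{}}"] by simp
  next
    case (Suc n)
    have "L (Suc n) \<subseteq> (\<lambda>(a, W). insert a W) ` (Field r \<times> L n)"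
    proof
      fix W assume "W \<in> L (Suc n)"
      then obtain a W' where "W = insert a W'" "a \<notin> W'" "card W' = n" "finite W" "W \<subseteq> Field r"
        unfolding L_def by (auto simp: card_Suc_eq)
      then show "W \<in> (\<lambda>(a, W). insert a W) ` (Field r \<times> L n)"
        unfolding L_def by (intro image_eqI[of _ _ "(a, W')"]) auto
    qed
    then show ?case by (rule subset_le[OF image_le[OF Sigma_le[OF Field_le Suc]]])
  qed
  have "Field (fin_dir r) = (\<Union>n. L n)" unfolding Field_fin_dir L_def by auto
  moreover have "|\<Union>n. L n| \<le>o r"
    by (rule UN_le[OF small_imp_le[OF countable_small] L]) simp
  ultimately show ?thesis by simp
qed

text \<open>Below a limit index there is no greatest element, so a strictly cofinal set exists, and
  one of least size exists because cardinals are well-ordered. Minimality makes every smaller set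
  bounded.\<close>

lemma ocof_olim:
  assumes "is_olim s \<xi>"
  obtains A where "ocof s \<xi> = |A|" "A \<subseteq> underS s \<xi>" "A \<noteq> {}"
    "\<And>\<eta>. \<eta> \<lhd> \<xi> \<Longrightarrow> \<exists>d\<in>A. \<eta> \<unlhd> d"
    "\<And>H. H \<subseteq> underS s \<xi> \<Longrightarrow> |H| <o |A| \<Longrightarrow> \<exists>\<eta>. \<eta> \<lhd> \<xi> \<and> (\<forall>h\<in>H. h \<unlhd> \<eta>)"
proof -
  let ?O = "Restr s (underS s \<xi>)"
  have FO: "Field ?O = underS s \<xi>"
  proof
    show "Field ?O \<subseteq> underS s \<xi>" unfolding Field_def by blast
    show "underS s \<xi> \<subseteq> Field ?O"
    proof
      fix a assume a: "a \<lhd> \<xi>"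
      then have "(a, a) \<in> ?O" using ole_refl[OF oless_Field(1)[OF a]] by blast
      then show "a \<in> Field ?O" unfolding Field_def by blast
    qed
  qed
  let ?R = "{|A| | A. A \<subseteq> Field ?O \<and> cofinal A ?O}"
  have "cofinal (underS s \<xi>) ?O" unfolding cofinal_def FO
  proof
    fix a assume a: "a \<lhd> \<xi>"
    have "a \<lhd> osuc s a" by (rule oless_osuc[OF oless_Field(1)[OF a]])
    then show "\<exists>b\<in>underS s \<xi>. a \<noteq> b \<and> (a, b) \<in> ?O"
      using osuc_oless_olim[OF assms a] a unfolding underS_def by blast
  qed
  then have "?R \<noteq> {}" using FO by blast
  moreover have "\<forall>k\<in>?R. Well_order k" using card_of_Well_order by blast
  ultimately have "\<exists>k\<in>?R. \<forall>k'\<in>?R. k \<le>o k'" by (rule exists_minim_Well_order)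
  then obtain A0 where "A0 \<subseteq> Field ?O \<and> cofinal A0 ?O \<and> (\<forall>B. B \<subseteq> Field ?O \<and> cofinal B ?O \<longrightarrow> |A0| \<le>o |B| )"
    by blast
  from someI[of "\<lambda>A. A \<subseteq> Field ?O \<and> cofinal A ?O \<and> (\<forall>B. B \<subseteq> Field ?O \<and> cofinal B ?O \<longrightarrow> |A| \<le>o |B| )", OF this]
  obtain A where A: "ocof s \<xi> = |A|" "A \<subseteq> Field ?O" "cofinal A ?O"
    and min: "\<forall>B. B \<subseteq> Field ?O \<and> cofinal B ?O \<longrightarrow> |A| \<le>o |B|"
    unfolding ocof_def cofinality_def by blast
  have nz: "ozero s \<lhd> \<xi>"
    using assms ozero_le ole_iff_oless_or_eq unfolding is_olim_def by metis
  show ?thesis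
  proof (rule that[OF A(1)])
    show "A \<subseteq> underS s \<xi>" using A(2) FO by blast
    show ex: "\<exists>d\<in>A. \<eta> \<unlhd> d" if "\<eta> \<lhd> \<xi>" for \<eta>
      using A(3) that unfolding cofinal_def FO by blast
    show "A \<noteq> {}" using ex[OF nz] by blast
    fix H assume H: "H \<subseteq> underS s \<xi>" "|H| <o |A|"
    have "\<not> cofinal H ?O"
    proof
      assume "cofinal H ?O"
      then have "|A| \<le>o |H|" using min H(1) FO by simp
      then show False using H(2) not_ordLess_ordLeq by blast
    qed
    then obtain a where a: "a \<lhd> \<xi>" "\<forall>b\<in>H. \<not> (a \<noteq> b \<and> (a, b) \<in> ?O)"
      unfolding cofinal_def FO by blast
    have "h \<unlhd> a" if h: "h \<in> H" for h
    proof -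
      have hx: "h \<lhd> \<xi>" using H(1) h by blast
      then have "\<not> a \<lhd> h" using bspec[OF a(2) h] a(1) unfolding underS_def by blast
      then show ?thesis using ole_or_oless[OF oless_Field(1)[OF hx] oless_Field(1)[OF a(1)]] by blast
    qed
    then show "\<exists>\<eta>. \<eta> \<lhd> \<xi> \<and> (\<forall>h\<in>H. h \<unlhd> \<eta>)" using a(1) by blast
  qed
qed

end

section \<open>Identification of the Baire classes\<close>

context nested_pair
begin

lemma hat_lim_const:
  assumes "f \<in> \<F>" "f \<in> topspace X \<rightarrow>\<^sub>E topspace Y" "Field D \<noteq> {}" "X.ole X.one \<xi>"
  shows "f \<in> hat_lim r \<xi> D X Y \<F>"
  unfolding hat_lim_def
  using assms(1-3) X.open_imp_Sig[OF openin_topspace assms(4)]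
  by (intro CollectI conjI exI[of _ "\<lambda>_. f"] exI[of _ "\<lambda>_. topspace X"]) auto

text \<open>For a successor the predecessor is the bound; for cofinality \<lambda> the bound comes
  from the minimality in \<open>ocof_olim\<close>.\<close>

lemma small_families_bounded:
  assumes "is_osuc X.s \<xi> \<or> is_olim X.s \<xi> \<and> ocof X.s \<xi> =o r"
    and H: "H \<subseteq> underS X.s \<xi>" "|H| <o r"
  shows "\<exists>\<eta>\<in>underS X.s \<xi>. \<forall>h\<in>H. X.ole h \<eta>"
  using assms(1)
proof
  assume "is_osuc X.s \<xi>"
  then obtain \<eta> where \<eta>: "\<eta> \<in> Field X.s" "\<xi> = osuc X.s \<eta>" unfolding is_osuc_def by blast
  show ?thesis
    by (rule bexI[of _ \<eta>]) (use H(1) X.oless_osuc_iff[OF \<eta>(1)] X.oless_osuc[OF \<eta>(1)] \<eta>(2) in auto)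
next
  assume a: "is_olim X.s \<xi> \<and> ocof X.s \<xi> =o r"
  then obtain A where A: "ocof X.s \<xi> = |A|"
    "\<And>H. H \<subseteq> underS X.s \<xi> \<Longrightarrow> |H| <o |A| \<Longrightarrow> \<exists>\<eta>. X.oless \<eta> \<xi> \<and> (\<forall>h\<in>H. X.ole h \<eta>)"
    using X.ocof_olim[of \<xi>] by metis
  have "|A| =o r" using a A(1) by simp
  then have "|H| <o |A|" by (rule ordLess_ordIso_trans[OF H(2) ordIso_symmetric])
  from A(2)[OF H(1) this] show ?thesis by blast
qed

text \<open>All constraints "\<open>P (a, k)\<close> is mapped into its class" are enumerated by
  \<lambda>, and a finite set \<open>W\<close> of indices gets a solution of its own system. If
  \<open>x \<in> P (a, k)\<close>, then every \<open>W\<close> containing the index of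
  \<open>(a, k)\<close> gives a value equivalent to \<open>f x\<close> at scale
  \<open>a\<close>.\<close>

lemma Meas_subset_net_lim_hat_lim:
  assumes f: "f \<in> Meas (osuc X.s \<xi>)" and lim: "is_olim X.s \<xi>" and small: "ocof X.s \<xi> <o r"
    and ne: "topspace Y \<noteq> {}"
  shows "f \<in> net_lim (fin_dir r) X Y (hat_lim r \<xi> (ocof X.s \<xi>) X Y (Meas_below \<xi>))"
proof -
  obtain A where A: "ocof X.s \<xi> = |A|" "A \<subseteq> underS X.s \<xi>" "A \<noteq> {}"
    "\<And>\<eta>. X.oless \<eta> \<xi> \<Longrightarrow> \<exists>d\<in>A. X.ole \<eta> d"
    "\<And>H. H \<subseteq> underS X.s \<xi> \<Longrightarrow> |H| <o |A| \<Longrightarrow> \<exists>\<eta>. X.oless \<eta> \<xi> \<and> (\<forall>h\<in>H. X.ole h \<eta>)"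
    using X.ocof_olim[OF lim] by blast
  have o: "X.ole X.one \<xi>" using X.one_le lim unfolding is_olim_def by blast
  have fF: "f \<in> topspace X \<rightarrow>\<^sub>E topspace Y" by (rule Meas_funcset[OF f])
  have fY: "f x \<in> topspace Y" if "x \<in> topspace X" for x
    using fF that by (auto simp: PiE_iff)
  have DF: "Field |A| = A" by (simp add: Field_card_of)
  \<comment> \<open>\<open>|A|\<close> is an initial well-order, so its proper initial segments are
    smaller than the cofinality and hence bounded below \<xi>; the larger of that bound and
    \<open>d\<close> serves.\<close>
  have bdd: "\<exists>\<zeta>\<in>underS X.s \<xi>. \<forall>d'\<in>under |A| d. X.ole d' \<zeta>" if d: "d \<in> Field |A|" for d
  proof -
    have "underS |A| d \<subseteq> A" using DF unfolding underS_def Field_def by blast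
    then have sub: "underS |A| d \<subseteq> underS X.s \<xi>" using A(2) by (rule subset_trans)
    obtain \<eta> where \<eta>: "X.oless \<eta> \<xi>" "\<forall>h\<in>underS |A| d. X.ole h \<eta>"
      using A(5)[OF sub card_of_underS[OF card_of_Card_order d]] by blast
    have dx: "X.oless d \<xi>" using d A(2) unfolding DF by blast
    obtain \<zeta> where \<zeta>: "X.oless \<zeta> \<xi>" "X.ole \<eta> \<zeta>" "X.ole d \<zeta>"
    proof (cases "X.ole \<eta> d")
      case True
      then show ?thesis using that[OF dx] X.ole_refl[OF X.oless_Field(1)[OF dx]] by blast
    next
      case False
      then have "X.ole d \<eta>"
        using X.ole_or_oless[OF X.oless_Field(1)[OF \<eta>(1)] X.oless_Field(1)[OF dx]] X.oless_imp_ole by blast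
      then show ?thesis using that[OF \<eta>(1)] X.ole_refl[OF X.oless_Field(1)[OF \<eta>(1)]] by blast
    qed
    have "X.ole d' \<zeta>" if "d' \<in> under |A| d" for d'
    proof (cases "d' = d")
      case False
      then have "d' \<in> underS |A| d" using that unfolding under_def underS_def by blast
      then show ?thesis using \<eta>(2) X.ole_trans \<zeta>(2) by blast
    qed (use \<zeta>(3) in simp)
    then show ?thesis using \<zeta>(1) by blast
  qed
  obtain P' v where P1': "\<And>a k. a \<in> Field r \<Longrightarrow> k \<in> Field r \<Longrightarrow> X.Pi0 \<xi> (P' a k)"
    and P2': "\<And>a x. a \<in> Field r \<Longrightarrow> x \<in> topspace X \<Longrightarrow> \<exists>k\<in>Field r. x \<in> P' a k"
    and P3': "\<And>a k x. a \<in> Field r \<Longrightarrow> k \<in> Field r \<Longrightarrow> x \<in> P' a k \<Longrightarrow> F a (v a k) (f x)"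
    using Meas_Pi0_covers[OF f o ne] by blast
  define P where "P t = P' (fst t) (snd t)" for t
  define V where "V t = {y. F (fst t) (v (fst t) (snd t)) y}" for t
  have P1: "X.Pi0 \<xi> (P t)" "\<And>x. x \<in> P t \<Longrightarrow> f x \<in> V t" if "t \<in> Field r \<times> Field r" for t
    using P1'[of "fst t" "snd t"] P3'[of "fst t" "snd t"] that unfolding P_def V_def
    by (auto simp: mem_Times_iff)
  have P2: "\<exists>k\<in>Field r. x \<in> P (a, k)" if "a \<in> Field r" "x \<in> topspace X" for a x
    using P2'[OF that] unfolding P_def by simp
  have "Field r \<times> Field r \<noteq> {}" using X.infinite_Field by auto
  then obtain p where p: "p ` Field r = Field r \<times> Field r"
    using X.obtain_enum[OF X.Sigma_le[OF X.Field_le X.Field_le]] by blast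
  have "\<forall>W\<in>Field (fin_dir r). \<exists>g. g \<in> hat_lim r \<xi> (ocof X.s \<xi>) X Y (Meas_below \<xi>) \<and>
    (\<forall>t\<in>p ` W. \<forall>x\<in>P t. g x \<in> V t)"
  proof
    fix W assume "W \<in> Field (fin_dir r)"
    then have W: "finite W" "W \<subseteq> Field r" unfolding X.Field_fin_dir by blast+
    have pW: "p ` W \<subseteq> Field r \<times> Field r" using p W(2) by blast
    have "\<exists>g\<in>hat_lim r \<xi> |A| X Y (Meas_below \<xi>). \<forall>t\<in>p ` W. \<forall>x\<in>P t. g x \<in> V t"
    proof (rule finite_constraints_hat_lim[OF lim card_of_Well_order _ _ _ bdd _ _ fY _ ne])
      show "Field |A| \<noteq> {}" using A(3) DF by simp
      show "|Field |A| | <o r" using small A(1) DF by simp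
      show "\<exists>d\<in>Field |A|. X.ole \<eta> d" if "X.oless \<eta> \<xi>" for \<eta> using A(4)[OF that] DF by simp
      show "finite (p ` W)" using W(1) by blast
      show "X.Pi0 \<xi> (P t)" if "t \<in> p ` W" for t by (rule P1(1)[OF subsetD[OF pW that]])
      show "f x \<in> V t" if "t \<in> p ` W" "x \<in> P t" for t x by (rule P1(2)[OF subsetD[OF pW that(1)] that(2)])
    qed
    then show "\<exists>g. g \<in> hat_lim r \<xi> (ocof X.s \<xi>) X Y (Meas_below \<xi>) \<and> (\<forall>t\<in>p ` W. \<forall>x\<in>P t. g x \<in> V t)"
      unfolding A(1) by blast
  qed
  from bchoice[OF this] obtain g where
    g: "\<forall>W\<in>Field (fin_dir r). g W \<in> hat_lim r \<xi> (ocof X.s \<xi>) X Y (Meas_below \<xi>) \<and>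
      (\<forall>t\<in>p ` W. \<forall>x\<in>P t. g W x \<in> V t)" ..
  have conv: "\<exists>d0\<in>Field (fin_dir r). \<forall>d. (d0, d) \<in> fin_dir r \<longrightarrow> g d x \<in> U"
    if x: "x \<in> topspace X" and U: "openin Y U" "f x \<in> U" for x U
  proof -
    obtain a where a: "a \<in> Field r" "\<And>y. F a (f x) y \<Longrightarrow> y \<in> U"
      using U unfolding Y.open_iff by blast
    obtain k where k: "k \<in> Field r" "x \<in> P (a, k)" using P2[OF a(1) x] by blast
    obtain i where i: "i \<in> Field r" "p i = (a, k)" using p a(1) k(1) by (metis SigmaI imageE)
    have "g W x \<in> U" if W: "({i}, W) \<in> fin_dir r" for W
    proof -
      have WF: "W \<in> Field (fin_dir r)" and iW: "i \<in> W"
        using W unfolding X.Field_fin_dir unfolding fin_dir_def by auto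
      have "(a, k) \<in> p ` W" using iW i(2) by force
      then have "g W x \<in> V (a, k)" using bspec[OF g WF] k(2) by blast
      then have 1: "F a (v a k) (g W x)" unfolding V_def by simp
      have "f x \<in> V (a, k)" using P1(2)[of "(a, k)"] a(1) k by blast
      then have "F a (v a k) (f x)" unfolding V_def by simp
      then have "F a (f x) (g W x)" by (rule Y.E_trans[OF Y.E_sym 1])
      then show ?thesis by (rule a(2))
    qed
    moreover have "{i} \<in> Field (fin_dir r)" unfolding X.Field_fin_dir using i(1) by blast
    ultimately show ?thesis by blast
  qed
  show ?thesis unfolding net_lim_def
    by (intro CollectI conjI fF exI[of _ g]) (use g conv in auto)
qed

text \<open>Both recursions are handled in one induction, since both then take limits of
  \<open>Meas_below \<xi>\<close>. The inclusions form a cycle: \<open>Meas\<close> in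
  \<open>Baire\<close> by approximation, \<open>Baire\<close> in \<open>Baire_hat\<close> by
  selecting particular directed sets, \<open>Baire_hat\<close> in \<open>Meas\<close> by the
  measurability of limits.\<close>

lemma Baire_classes:
  assumes "\<xi> \<in> Field X.s"
  shows "Baire r X Y \<xi> = Meas (osuc X.s \<xi>) \<and> Baire_hat r X Y \<xi> = Meas (osuc X.s \<xi>)"
  using assms
proof (induction \<xi> rule: X.oless_induct)
  case (less \<xi>)
  have B: "(\<Union>\<eta>\<in>underS X.s \<xi>. Baire r X Y \<eta>) = Meas_below \<xi>"
    and Bh: "(\<Union>\<eta>\<in>underS X.s \<xi>. Baire_hat r X Y \<eta>) = Meas_below \<xi>"
    using less.IH by simp_all
  show ?case
  proof (cases "\<xi> = ozero X.s")
    case True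
    have "continuous_fun X Y = Meas X.one"
      unfolding continuous_fun_def measurable_fun_def X.Sig_one_iff continuous_map_def
      by (auto simp: PiE_iff)
    then show ?thesis
      unfolding True Baire_ozero[OF X.card] Baire_hat_ozero[OF X.card] by simp
  next
    case False
    have o: "X.ole X.one \<xi>" by (rule X.one_le[OF less.hyps False])
    note hat = Baire_hat_pos[OF X.card False, of X Y, unfolded Bh]
    have hat_sub: "Baire_hat r X Y \<xi> \<subseteq> Meas (osuc X.s \<xi>)"
    proof -
      have "hat_lim r \<xi> D X Y (Meas_below \<xi>) \<subseteq> Meas \<xi>" if "D \<in> small_directed r" for D
        by (rule hat_lim_subset_Meas[OF Meas_below_subset _ _ o])
          (use that in \<open>auto simp: small_directed_def directed_rel_def preorder_on_def refl_on_def\<close>)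
      then have "(\<Union>D\<in>small_directed r. hat_lim r \<xi> D X Y (Meas_below \<xi>)) \<subseteq> Meas \<xi>" by blast
      then have "net_lim D X Y (\<Union>D\<in>small_directed r. hat_lim r \<xi> D X Y (Meas_below \<xi>)) \<subseteq> Meas (osuc X.s \<xi>)"
        if "D \<in> small_directed r" for D
        by (rule net_lim_subset_Meas[OF _ _ _ o]) (use that in \<open>auto simp: small_directed_def\<close>)
      then show ?thesis unfolding hat by blast
    qed
    have Fne: "Field r \<noteq> {}" using X.infinite_Field by auto
    have below: "Meas_below \<xi> \<subseteq> topspace X \<rightarrow>\<^sub>E topspace Y" unfolding measurable_fun_def by blast
    have small_image: "\<exists>D'\<in>small_directed r. net_lim D X Y \<F> \<subseteq> net_lim D' X Y \<F> \<and>
        hat_lim r \<xi> D X Y \<F> \<subseteq> hat_lim r \<xi> D' X Y \<F>"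
      if D: "directed_rel D" "|Field D| \<le>o r" for D :: "'l set rel" and \<F> :: "('a \<Rightarrow> 'b) set"
    proof -
      have "|Field D| \<le>o |Field r|"
        by (rule ordLeq_ordIso_trans[OF D(2) ordIso_symmetric[OF card_of_Field_ordIso[OF X.card]]])
      then obtain h where h: "inj_on h (Field D)" "h ` Field D \<subseteq> Field r"
        using card_of_ordLeq[of "Field D" "Field r"] by blast
      have "dir_image D h \<in> small_directed r"
        unfolding small_directed_def dir_image_Field
        using directed_dir_image[OF D(1) h(1)] X.subset_le[OF X.Field_le h(2)] by (simp add: dir_image_Field)
      then show ?thesis using net_lim_dir_image[OF h(1)] hat_lim_dir_image[OF h(1)] by blast
    qed
    have rD: "directed_rel r"
      by (rule Well_order_directed[OF _ Fne]) (use X.wo in \<open>simp add: wo_rel_def\<close>)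
    have rsmall: "r \<in> small_directed r" unfolding small_directed_def using rD X.Field_le by blast
    \<comment> \<open>The approximations need a point of \<open>Y\<close>. If there is none,
      \<open>X\<close> is empty as well and \<open>f\<close> is continuous.\<close>
    have empty: "f \<in> Meas_below \<xi>" if f: "f \<in> Meas (osuc X.s \<xi>)" and "topspace Y = {}" for f
    proof -
      have "topspace X = {}" using Meas_funcset[OF f] that(2) by (auto simp: PiE_iff)
      then have "f \<in> Meas X.one"
        using Meas_funcset[OF f] X.open_imp_Sig[OF openin_empty X.ole_refl[OF X.one_Field]]
        unfolding measurable_fun_def by simp
      then show ?thesis using X.oless_ole_trans[OF X.oless_osuc[OF X.ozero_Field] o] by blast
    qed
    let ?\<G> = "\<Union>D\<in>small_directed r. hat_lim r \<xi> D X Y (Meas_below \<xi>)"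
    consider (big) "is_osuc X.s \<xi> \<or> is_olim X.s \<xi> \<and> ocof X.s \<xi> =o r"
      | (small) "is_olim X.s \<xi>" "ocof X.s \<xi> <o r"
    proof (cases "is_osuc X.s \<xi>")
      case True
      then show ?thesis using that(1) by blast
    next
      case nsuc: False
      have lim: "is_olim X.s \<xi>" unfolding is_olim_def using less.hyps False nsuc by blast
      obtain A where A: "ocof X.s \<xi> = |A|" "A \<subseteq> underS X.s \<xi>"
        using X.ocof_olim[OF lim] by metis
      have "|A| \<le>o r" by (rule X.subset_le[OF X.card_underS_le A(2)])
      then have "ocof X.s \<xi> <o r \<or> ocof X.s \<xi> =o r" unfolding A(1) by (simp only: ordLeq_iff_ordLess_or_ordIso)
      then show ?thesis using that lim by blast
    qed
    then show ?thesis
    proof cases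
      case big
      have eq: "Baire r X Y \<xi> = net_lim r X Y (Meas_below \<xi>)"
        using Baire_lambda[OF X.card X.infinite_Field big, of X Y] unfolding B .
      have "Meas_below \<xi> \<subseteq> hat_lim r \<xi> r X Y (Meas_below \<xi>)"
        by (rule subsetI, rule hat_lim_const[OF _ _ Fne o]) (use below in auto)
      also have "\<dots> \<subseteq> ?\<G>" by (rule UN_upper[OF rsmall])
      finally have "net_lim r X Y (Meas_below \<xi>) \<subseteq> net_lim r X Y ?\<G>" by (rule net_lim_mono)
      also have "\<dots> \<subseteq> Baire_hat r X Y \<xi>" unfolding hat by (rule UN_upper[OF rsmall])
      finally have "Baire r X Y \<xi> \<subseteq> Baire_hat r X Y \<xi>" unfolding eq .
      moreover have "Meas (osuc X.s \<xi>) \<subseteq> Baire r X Y \<xi>"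
      proof
        fix f assume f: "f \<in> Meas (osuc X.s \<xi>)"
        show "f \<in> Baire r X Y \<xi>"
        proof (cases "topspace Y = {}")
          case True
          then have "f \<in> Meas_below \<xi>" by (rule empty[OF f])
          then show ?thesis unfolding eq by (rule net_lim_const[OF _ Meas_funcset[OF f] Fne])
        next
          case False
          show ?thesis unfolding eq
            by (rule Meas_subset_net_lim[OF f o False small_families_bounded[OF big]])
        qed
      qed
      ultimately show ?thesis using hat_sub by blast
    next
      case small
      have eq: "Baire r X Y \<xi> = net_lim (fin_dir r) X Y (hat_lim r \<xi> (ocof X.s \<xi>) X Y (Meas_below \<xi>))"
        using Baire_small_cof[OF X.card small, of X Y] unfolding B .
      obtain A where A: "ocof X.s \<xi> = |A|" "A \<subseteq> underS X.s \<xi>" "A \<noteq> {}"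
        using X.ocof_olim[OF small(1)] by metis
      have AF: "Field (ocof X.s \<xi>) = A" unfolding A(1) by (simp add: Field_card_of)
      have "directed_rel (ocof X.s \<xi>)"
        unfolding A(1)
        by (rule Well_order_directed[OF card_of_Well_order]) (use A(3) in \<open>simp add: Field_card_of\<close>)
      moreover have "|Field (ocof X.s \<xi>)| \<le>o r"
        unfolding AF by (rule X.subset_le[OF X.card_underS_le A(2)])
      ultimately obtain D' where D': "D' \<in> small_directed r"
        "hat_lim r \<xi> (ocof X.s \<xi>) X Y (Meas_below \<xi>) \<subseteq> hat_lim r \<xi> D' X Y (Meas_below \<xi>)"
        using small_image[of "ocof X.s \<xi>" "Meas_below \<xi>"] by blast
      obtain D where D: "D \<in> small_directed r" "net_lim (fin_dir r) X Y ?\<G> \<subseteq> net_lim D X Y ?\<G>"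
        using small_image[OF X.directed_fin_dir X.fin_dir_le, of ?\<G>] by blast
      have "Baire r X Y \<xi> \<subseteq> net_lim (fin_dir r) X Y ?\<G>"
        unfolding eq by (rule net_lim_mono, rule subset_trans[OF D'(2)], rule UN_upper[OF D'(1)])
      also note D(2)
      also have "net_lim D X Y ?\<G> \<subseteq> Baire_hat r X Y \<xi>" unfolding hat by (rule UN_upper[OF D(1)])
      finally have "Baire r X Y \<xi> \<subseteq> Baire_hat r X Y \<xi>" .
      moreover have "Meas (osuc X.s \<xi>) \<subseteq> Baire r X Y \<xi>"
      proof
        fix f assume f: "f \<in> Meas (osuc X.s \<xi>)"
        show "f \<in> Baire r X Y \<xi>"
        proof (cases "topspace Y = {}")
          case True
          then have "f \<in> Meas_below \<xi>" by (rule empty[OF f])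
          then have "f \<in> hat_lim r \<xi> (ocof X.s \<xi>) X Y (Meas_below \<xi>)"
            by (rule hat_lim_const[OF _ Meas_funcset[OF f] _ o]) (use A(3) AF in simp)
          then show ?thesis unfolding eq
            by (rule net_lim_const[OF _ Meas_funcset[OF f]]) (use X.Field_fin_dir in blast)
        next
          case False
          show ?thesis unfolding eq by (rule Meas_subset_net_lim_hat_lim[OF f small False])
        qed
      qed
      ultimately show ?thesis using hat_sub by blast
    qed
  qed
qed

end

section \<open>Nested equivalence relations from metrics\<close>

text \<open>Distance of order at most \<open>e a\<close>. Allowing every finite multiple is what
  makes the relation transitive.\<close>

definition scale_equiv ::
    "'a topology \<Rightarrow> ('a \<Rightarrow> 'a \<Rightarrow> 'g::linordered_field) \<Rightarrow> ('l \<Rightarrow> 'g) \<Rightarrow> 'l \<Rightarrow> 'a \<Rightarrow> 'a \<Rightarrow> bool" where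
  "scale_equiv X d e a x y \<longleftrightarrow>
     x \<in> topspace X \<and> y \<in> topspace X \<and> (\<exists>n::nat. d x y \<le> of_nat n * e a)"

context regular_cardinal
begin

text \<open>If no positive element lies strictly below \<open>S\<close>, then \<open>S\<close> is
  itself coinitial and so has size at least \<lambda>.\<close>

lemma small_pos_lower_bound:
  fixes S :: "'g::linordered_field set"
  assumes "has_coinitiality TYPE('g) (cofinality r)" "S \<subseteq> {0<..}" "|S| <o r"
  shows "\<exists>x>0. \<forall>c\<in>S. x < c"
proof (rule ccontr)
  assume "\<not> ?thesis"
  then have "coinitial_pos S" unfolding coinitial_pos_def using assms(2) by (meson not_less)
  then have "cofinality r \<le>o |S|" using assms(1) unfolding has_coinitiality_def by blast
  then have "r \<le>o |S|" by (rule ordIso_ordLeq_trans[OF ordIso_symmetric[OF cofinality_ordIso]])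
  then show False using assms(3) not_ordLess_ordLeq by blast
qed

text \<open>Uncountability of \<open>\<lambda>\<close> makes room below all \<open>e b / n\<close>, so consecutive scales can be chosen
  infinitely far apart. This turns the metric into nested equivalence relations.\<close>

lemma infinitesimal_scale:
  assumes "has_coinitiality TYPE('g::linordered_field) (cofinality r)"
  obtains e :: "'l \<Rightarrow> 'g::linordered_field" where "\<And>a. a \<in> Field r \<Longrightarrow> 0 < e a"
    "\<And>a b n. a \<in> Field r \<Longrightarrow> b \<in> underS r a \<Longrightarrow> of_nat n * e a \<le> e b"
    "\<And>x. 0 < x \<Longrightarrow> \<exists>a\<in>Field r. e a \<le> x"
proof -
  obtain C :: "'g set" where C: "coinitial_pos C" "|C| =o cofinality r"
    using assms unfolding has_coinitiality_def by blast
  have "C \<noteq> {}" using C(1) zero_less_one unfolding coinitial_pos_def by blast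
  moreover have "|C| \<le>o r" by (rule ordIso_imp_ordLeq[OF ordIso_transitive[OF C(2) cofinality_ordIso]])
  ultimately obtain c where c: "c ` Field r = C" using obtain_enum by metis
  have cpos: "0 < c a" if "a \<in> Field r" for a
    using c C(1) that unfolding coinitial_pos_def by force
  \<comment> \<open>The bound by \<open>c a\<close> makes the scale coinitial; the last clause puts
    \<open>x\<close> infinitely far below all earlier scales.\<close>
  define Q where "Q e a x \<longleftrightarrow> 0 < x \<and> x \<le> c a \<and> (\<forall>b\<in>underS r a. \<forall>n::nat. of_nat n * x \<le> e b)" for e a x
  define H where "H e a = (SOME x. Q e a x)" for e a
  define e where "e = wo_rel.worec r H"
  have "H f a = H g a" if "\<forall>b\<in>underS r a. f b = g b" for f g a
    unfolding H_def Q_def using that by simp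
  then have "wo_rel.adm_wo r H" unfolding wo_rel.adm_wo_def[OF wo] by blast
  from wo_rel.worec_fixpoint[OF wo this] have e: "e a = H e a" for a
    unfolding e_def by (rule fun_cong)
  have Q: "a \<in> Field r \<longrightarrow> Q e a (e a)" for a
  proof (induction a rule: wo_rel.well_order_induct[OF wo])
    case (1 a)
    show ?case
    proof
      assume a: "a \<in> Field r"
      have pos: "0 < e b" if "b \<in> underS r a" for b
      proof -
        have "b \<noteq> a \<and> (b, a) \<in> r" "b \<in> Field r" using that unfolding underS_def Field_def by auto
        then show ?thesis using 1 unfolding Q_def by blast
      qed
      let ?S = "insert (c a) ((\<lambda>(b, n). e b / of_nat (Suc n)) ` (underS r a \<times> (UNIV :: nat set)))"
      have sm: "|?S| <o r"
        by (intro insert_small image_small Sigma_small underS_small countable_small) simp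
      have sub: "?S \<subseteq> {0<..}" using cpos[OF a] pos by (auto simp del: of_nat_Suc)
      obtain x where x: "0 < x" "\<forall>t\<in>?S. x < t" using small_pos_lower_bound[OF assms sub sm] by blast
      have "of_nat n * x \<le> e b" if b: "b \<in> underS r a" for b and n :: nat
      proof (cases n)
        case 0
        then show ?thesis using pos[OF b] by simp
      next
        case (Suc m)
        have "e b / of_nat (Suc m) \<in> ?S" using b by force
        then have "x < e b / of_nat (Suc m)" using x(2) by blast
        then have "x * of_nat (Suc m) < e b" by (simp add: pos_less_divide_eq del: of_nat_Suc)
        then show ?thesis unfolding Suc by (simp add: mult.commute del: of_nat_Suc)
      qed
      then have "Q e a x" unfolding Q_def using x by (auto intro: less_imp_le)
      then have "Q e a (H e a)" unfolding H_def by (rule someI)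
      then show "Q e a (e a)" using e by simp
    qed
  qed
  show ?thesis
  proof
    show "0 < e a" if "a \<in> Field r" for a using Q that unfolding Q_def by blast
    show "of_nat n * e a \<le> e b" if "a \<in> Field r" "b \<in> underS r a" for a b n
      using Q that unfolding Q_def by blast
    fix x :: 'g assume "0 < x"
    then obtain t where "t \<in> C" "t \<le> x" using C(1) unfolding coinitial_pos_def by blast
    then obtain a where "a \<in> Field r" "c a \<le> x" using c by blast
    moreover have "e a \<le> c a" using Q \<open>a \<in> Field r\<close> unfolding Q_def by blast
    ultimately show "\<exists>a\<in>Field r. e a \<le> x" by (meson order_trans)
  qed
qed

end

section \<open>Balls and classes of a metric\<close>

locale metric_scale = regular_cardinal r for r :: "'l rel" +
  fixes X :: "'a topology" and d :: "'a \<Rightarrow> 'a \<Rightarrow> 'g::linordered_field" and e :: "'l \<Rightarrow> 'g"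
  assumes metric: "compatible_metric X d"
    and scale_pos: "\<And>a. a \<in> Field r \<Longrightarrow> 0 < e a"
    and scale_less: "\<And>a b n. a \<in> Field r \<Longrightarrow> b \<in> underS r a \<Longrightarrow> of_nat n * e a \<le> e b"
    and scale_coinitial: "\<And>x. 0 < x \<Longrightarrow> \<exists>a\<in>Field r. e a \<le> x"
begin

lemma metric_props:
  assumes "x \<in> topspace X" "y \<in> topspace X"
  shows "d x y = d y x" "d x x = 0" "z \<in> topspace X \<Longrightarrow> d x z \<le> d x y + d y z"
  using metric assms unfolding compatible_metric_def field_metric_def by blast+

lemma scale_equiv_sym: "scale_equiv X d e a x y \<Longrightarrow> scale_equiv X d e a y x"
  unfolding scale_equiv_def using metric_props(1) by metis

lemma scale_equiv_trans:
  assumes "scale_equiv X d e a x y" "scale_equiv X d e a y z"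
  shows "scale_equiv X d e a x z"
proof -
  obtain n m :: nat where nm: "d x y \<le> of_nat n * e a" "d y z \<le> of_nat m * e a"
    using assms unfolding scale_equiv_def by blast
  have "d x z \<le> d x y + d y z"
    using metric_props(3) assms unfolding scale_equiv_def by blast
  also have "\<dots> \<le> of_nat (n + m) * e a" using add_mono[OF nm] by (simp add: distrib_right)
  finally show ?thesis using assms unfolding scale_equiv_def by blast
qed

text \<open>Together with \<open>le_imp_scale_equiv\<close> this interleaves balls and classes: the
  closed ball of radius \<open>e a\<close> lies between the \<open>b\<close>-class, for any
  \<open>b\<close> above \<open>a\<close>, and the \<open>a\<close>-class of its centre.\<close>

lemma scale_equiv_imp_le:
  assumes "scale_equiv X d e b x y" "b \<in> Field r" "a \<in> underS r b"
  shows "d x y \<le> e a"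
  using assms scale_less[OF assms(2,3)] unfolding scale_equiv_def by (meson order_trans)

lemma le_imp_scale_equiv:
  assumes "d x y \<le> e a" "x \<in> topspace X" "y \<in> topspace X"
  shows "scale_equiv X d e a x y"
  unfolding scale_equiv_def using assms by (intro conjI exI[of _ "1::nat"]) auto

lemma scale_equiv_mono:
  assumes "(a, b) \<in> r" "scale_equiv X d e b x y"
  shows "scale_equiv X d e a x y"
proof (cases "a = b")
  case False
  then have "a \<in> underS r b" "b \<in> Field r" using assms(1) unfolding underS_def Field_def by auto
  then have "d x y \<le> e a" using scale_equiv_imp_le assms(2) by blast
  then show ?thesis using le_imp_scale_equiv assms(2) unfolding scale_equiv_def by blast
qed (use assms in simp)

sublocale nested_space r X "scale_equiv X d e"
proof
  show "scale_equiv X d e a x x" if "x \<in> topspace X" for a x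
    unfolding scale_equiv_def using that metric_props(2)[OF that that]
    by (intro conjI exI[of _ "0::nat"]) auto
  show "openin X U \<longleftrightarrow> U \<subseteq> topspace X \<and>
      (\<forall>x\<in>U. \<exists>a\<in>Field r. \<forall>y. scale_equiv X d e a x y \<longrightarrow> y \<in> U)" for U
  proof -
    have eqv: "(\<exists>t>0. {y \<in> topspace X. d x y < t} \<subseteq> U) \<longleftrightarrow>
        (\<exists>a\<in>Field r. \<forall>y. scale_equiv X d e a x y \<longrightarrow> y \<in> U)" if x: "x \<in> topspace X" for x
    proof
      assume "\<exists>t>0. {y \<in> topspace X. d x y < t} \<subseteq> U"
      then obtain t where t: "0 < t" "{y \<in> topspace X. d x y < t} \<subseteq> U" by blast
      obtain b where b: "b \<in> Field r" "e b \<le> t" using scale_coinitial[OF t(1)] by blast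
      obtain a where a: "a \<in> Field r" "b \<noteq> a" "(b, a) \<in> r"
        using infinite_Card_order_limit[OF card infinite_Field b(1)] by blast
      have ba: "b \<in> underS r a" using a unfolding underS_def by blast
      have "y \<in> U" if y: "scale_equiv X d e a x y" for y
      proof -
        obtain n :: nat where n: "d x y \<le> of_nat n * e a" using y unfolding scale_equiv_def by blast
        \<comment> \<open>One multiple more turns the weak bound of the class into the strict one of
          an open ball.\<close>
        also have "\<dots> < of_nat (Suc n) * e a" using scale_pos[OF a(1)] by (simp add: distrib_right)
        also have "\<dots> \<le> e b" by (rule scale_less[OF a(1) ba])
        also note b(2)
        finally have "d x y < t" .
        then show ?thesis using t(2) y unfolding scale_equiv_def by blast
      qed
      then show "\<exists>a\<in>Field r. \<forall>y. scale_equiv X d e a x y \<longrightarrow> y \<in> U" using a(1) by blast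
    next
      assume "\<exists>a\<in>Field r. \<forall>y. scale_equiv X d e a x y \<longrightarrow> y \<in> U"
      then obtain a where a: "a \<in> Field r" "\<And>y. scale_equiv X d e a x y \<Longrightarrow> y \<in> U" by blast
      have "{y \<in> topspace X. d x y < e a} \<subseteq> U"
        using a(2) le_imp_scale_equiv x less_imp_le by blast
      then show "\<exists>t>0. {y \<in> topspace X. d x y < t} \<subseteq> U" using scale_pos[OF a(1)] by blast
    qed
    have op: "openin X U \<longleftrightarrow> U \<subseteq> topspace X \<and> (\<forall>x\<in>U. \<exists>t>0. {y \<in> topspace X. d x y < t} \<subseteq> U)"
      using metric unfolding compatible_metric_def by blast
    show ?thesis unfolding op by (intro conj_cong refl ball_cong eqv) blast
  qed
qed (fact scale_equiv_sym scale_equiv_trans scale_equiv_mono | simp add: scale_equiv_def)+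

text \<open>Classes need not be closed balls. The \<open>a\<close>-class is replaced by a ball of
  radius \<open>e a\<close> inside it, centred at the point of a later index; such balls decrease,
  and a common point of them lies in all classes.\<close>

lemma spherical_scale:
  assumes sph: "\<forall>(s :: 'a set rel) x t.
           Well_order s \<and> Field s \<noteq> {} \<and>
           (\<forall>i\<in>Field s. x i \<in> topspace X \<and> 0 < t i) \<and>
           (\<forall>(i, j)\<in>s. closed_ball X d (x j) (t j) \<subseteq> closed_ball X d (x i) (t i)) \<longrightarrow>
           (\<Inter>i\<in>Field s. closed_ball X d (x i) (t i)) \<noteq> {}"
    and B: "B \<subseteq> Field r" "B \<noteq> {}"
    and z: "\<And>a b. a \<in> B \<Longrightarrow> b \<in> B \<Longrightarrow> (a, b) \<in> r \<Longrightarrow> scale_equiv X d e a (z a) (z b)"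
  shows "\<exists>y. \<forall>a\<in>B. scale_equiv X d e a (z a) y"
proof (cases "\<exists>m\<in>B. \<forall>a\<in>B. (a, m) \<in> r")
  case True
  \<comment> \<open>If \<open>B\<close> has a greatest element, its point lies in all
    classes.\<close>
  then show ?thesis using z by blast
next
  case False
  have "\<forall>a\<in>B. \<exists>a'. a' \<in> B \<and> a \<in> underS r a'"
  proof
    fix a assume a: "a \<in> B"
    then obtain a' where a': "a' \<in> B" "(a', a) \<notin> r" using False by blast
    then have "(a, a') \<in> r" "a \<noteq> a'" using wo_rel.TOTALS[OF wo] B(1) a by blast+
    then show "\<exists>a'. a' \<in> B \<and> a \<in> underS r a'" using a'(1) unfolding underS_def by blast
  qed
  from bchoice[OF this] obtain nx where nx: "\<forall>a\<in>B. nx a \<in> B \<and> a \<in> underS r (nx a)" ..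
  have zX: "z a \<in> topspace X" if "a \<in> B" for a
    using z[OF that _, of "nx a"] nx that E_in unfolding underS_def by blast
  have znx: "scale_equiv X d e a (z a) (z (nx a))" if "a \<in> B" for a
    using z[OF that] nx that unfolding underS_def by blast
  \<comment> \<open>The centre is taken at the later index \<open>nx a\<close>: further points agree
    with it at a scale finer than \<open>a\<close>, hence within the exact radius \<open>e a\<close>
    and not merely a multiple of it.\<close>
  define ball where "ball a = closed_ball X d (z (nx a)) (e a)" for a
  have ball_equiv: "scale_equiv X d e a (z a) u" if "a \<in> B" "u \<in> ball a" for a u
    using E_trans[OF znx[OF that(1)]] le_imp_scale_equiv[of "z (nx a)" u a] zX nx that
    unfolding ball_def closed_ball_def by blast
  have ball_anti: "ball b \<subseteq> ball a" if ab: "a \<in> B" "b \<in> B" "(a, b) \<in> r" for a b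
  proof (cases "a = b")
    case False
    show ?thesis
    proof
      fix u assume u: "u \<in> ball b"
      have bu: "scale_equiv X d e b (z b) u" by (rule ball_equiv[OF ab(2) u])
      have na: "nx a \<in> B" "a \<in> underS r (nx a)" using nx ab(1) by blast+
      have "d (z (nx a)) u \<le> e a"
      \<comment> \<open>The index \<open>nx a\<close> was chosen freely above \<open>a\<close> and
        may exceed \<open>b\<close>; the smaller of the two is in either case finer than
        \<open>a\<close>.\<close>
      proof (cases "(b, nx a) \<in> r")
        case True
        have "scale_equiv X d e b (z (nx a)) u"
          using E_trans[OF E_sym[OF z[OF ab(2) na(1) True]] bu] .
        moreover have "a \<in> underS r b" using ab(3) False unfolding underS_def by blast
        ultimately show ?thesis using scale_equiv_imp_le ab(2) B(1) by blast
      next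
        case False
        then have c: "(nx a, b) \<in> r" using wo_rel.TOTALS[OF wo] ab(2) na(1) B(1) by blast
        have "scale_equiv X d e (nx a) (z (nx a)) u"
          using E_trans[OF z[OF na(1) ab(2) c] E_mono[OF c bu]] .
        then show ?thesis using scale_equiv_imp_le na B(1) by blast
      qed
      then show "u \<in> ball a" unfolding ball_def closed_ball_def using E_in[OF bu] by blast
    qed
  qed simp
  \<comment> \<open>Spherical completeness expects a well-order on sets of points, so the balls
    index themselves by reverse inclusion. Different indices may give the same ball, whence the
    selector \<mu>, through which well-foundedness is pulled back from \<open>r\<close>.\<close>
  define s where "s = {(S, T). S \<in> ball ` B \<and> T \<in> ball ` B \<and> T \<subseteq> S}"
  have Fs: "Field s = ball ` B" unfolding s_def Field_def by auto
  define \<mu> where "\<mu> = inv_into B ball"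
  have \<mu>: "\<mu> S \<in> B" "ball (\<mu> S) = S" if "S \<in> ball ` B" for S
    unfolding \<mu>_def by (rule inv_into_into[OF that], rule f_inv_into_f[OF that])
  have tot: "S \<subseteq> T \<or> T \<subseteq> S" if "S \<in> ball ` B" "T \<in> ball ` B" for S T
    using that ball_anti wo_rel.TOTALS[OF wo] B(1) by blast
  have "s - Id \<subseteq> inv_image (r - Id) \<mu>"
  proof
    fix p assume "p \<in> s - Id"
    then obtain S T where p: "p = (S, T)" and ST: "S \<in> ball ` B" "T \<in> ball ` B" "T \<subseteq> S" "S \<noteq> T"
      unfolding s_def by blast
    have "(\<mu> T, \<mu> S) \<notin> r"
      using ball_anti[OF \<mu>(1)[OF ST(2)] \<mu>(1)[OF ST(1)]] \<mu>(2) ST by auto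
    moreover have "\<mu> S \<in> Field r" "\<mu> T \<in> Field r" using \<mu>(1) ST B(1) by blast+
    ultimately have "(\<mu> S, \<mu> T) \<in> r" using wo_rel.TOTALS[OF wo] by blast
    moreover have "\<mu> S \<noteq> \<mu> T" using \<mu>(2)[OF ST(1)] \<mu>(2)[OF ST(2)] ST(4) by metis
    ultimately have "(\<mu> S, \<mu> T) \<in> r - Id" by simp
    then show "p \<in> inv_image (r - Id) \<mu>" unfolding p by simp
  qed
  then have "wf (s - Id)" by (rule wf_subset[OF wf_inv_image[OF wo_rel.WF[OF wo]]])
  moreover have "Linear_order s"
    unfolding linear_order_on_def partial_order_on_def preorder_on_def Fs
    using tot by (auto simp: s_def refl_on_def trans_def antisym_def total_on_def)
  ultimately have "Well_order s" unfolding well_order_on_def by blast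
  moreover have "Field s \<noteq> {}" unfolding Fs using B(2) by blast
  moreover have "\<forall>S\<in>Field s. z (nx (\<mu> S)) \<in> topspace X \<and> 0 < e (\<mu> S)"
    unfolding Fs using \<mu>(1) zX nx scale_pos B(1) by blast
  moreover have "\<forall>(S, T)\<in>s. closed_ball X d (z (nx (\<mu> T))) (e (\<mu> T)) \<subseteq> closed_ball X d (z (nx (\<mu> S))) (e (\<mu> S))"
    using \<mu>(2) unfolding s_def ball_def[symmetric] by auto
  ultimately have "(\<Inter>S\<in>Field s. closed_ball X d (z (nx (\<mu> S))) (e (\<mu> S))) \<noteq> {}"
    using sph[rule_format, of s "\<lambda>S. z (nx (\<mu> S))" "\<lambda>S. e (\<mu> S)"] by blast
  then obtain u where u: "\<And>S. S \<in> ball ` B \<Longrightarrow> u \<in> ball (\<mu> S)" unfolding Fs ball_def[symmetric] by blast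
  have "u \<in> ball a" if "a \<in> B" for a using u[of "ball a"] \<mu>(2)[of "ball a"] that by auto
  then show ?thesis using ball_equiv by blast
qed

lemma weight_le_dense:
  assumes "weight_le X r"
  shows "\<exists>Q. Q \<subseteq> topspace X \<and> |Q| \<le>o r \<and> (\<forall>a\<in>Field r. \<forall>y\<in>topspace X. \<exists>q\<in>Q. scale_equiv X d e a q y)"
proof -
  obtain \<B> where \<B>: "|\<B>| \<le>o r" "\<forall>V\<in>\<B>. openin X V"
    "\<forall>U x. openin X U \<and> x \<in> U \<longrightarrow> (\<exists>V\<in>\<B>. x \<in> V \<and> V \<subseteq> U)"
    using assms unfolding weight_le_def by blast
  define pt where "pt V = (SOME y. y \<in> V)" for V :: "'a set"
  have pt: "pt V \<in> V" if "V \<noteq> {}" for V unfolding pt_def using that by (simp add: some_in_eq)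
  define Q where "Q = pt ` {V \<in> \<B>. V \<noteq> {}}"
  have "|Q| \<le>o r" unfolding Q_def by (rule image_le[OF subset_le[OF \<B>(1)]]) blast
  moreover have "Q \<subseteq> topspace X" unfolding Q_def using pt \<B>(2) openin_subset by blast
  moreover have "\<exists>q\<in>Q. scale_equiv X d e a q y" if ay: "a \<in> Field r" "y \<in> topspace X" for a y
  proof -
    have C: "openin X {q. scale_equiv X d e a y q} \<and> y \<in> {q. scale_equiv X d e a y q}"
      using open_class(1)[OF ay(1)] E_refl[OF ay(2)] by simp
    obtain V where V: "V \<in> \<B>" "y \<in> V" "V \<subseteq> {q. scale_equiv X d e a y q}"
      using \<B>(3)[THEN spec, THEN spec, THEN mp, OF C] by blast
    then have "pt V \<in> Q" "scale_equiv X d e a y (pt V)" using pt[of V] unfolding Q_def by blast+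
    then show ?thesis using E_sym by blast
  qed
  ultimately show ?thesis by blast
qed

end

theorem theorem6p14:
  fixes r :: "'l rel"
    and X :: "'a topology"
    and Y :: "'b topology"
    and \<xi> :: "'l set"
  assumes "Card_order r"
    and "natLeq <o r"
    and "weak_two_power_eq r"
    and "regularCard r"
    and "has_coinitiality TYPE('g::linordered_field) (cofinality r)"
    and "metrizable_class TYPE('g) r X"
    and "metrizable_class TYPE('g) r Y"
    and "spherically_complete TYPE('g) Y"
    and "\<xi> \<in> Field (cardSuc r)"
  shows "Baire r X Y \<xi> = Baire_hat r X Y \<xi> \<and>
         Baire_hat r X Y \<xi> = measurable_fun r X Y (osuc (cardSuc r) \<xi>)"
proof -
  interpret regular_cardinal r
    using assms(1,2,3,4) unfolding weak_two_power_eq_def by unfold_locales auto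
  obtain e :: "'l \<Rightarrow> 'g" where e: "\<And>a. a \<in> Field r \<Longrightarrow> 0 < e a"
    "\<And>a b n. a \<in> Field r \<Longrightarrow> b \<in> underS r a \<Longrightarrow> of_nat n * e a \<le> e b"
    "\<And>x. 0 < x \<Longrightarrow> \<exists>a\<in>Field r. e a \<le> x"
    using infinitesimal_scale[OF assms(5)] by blast
  obtain d1 :: "'a \<Rightarrow> 'a \<Rightarrow> 'g" where d1: "compatible_metric X d1"
    using assms(6) unfolding metrizable_class_def by blast
  \<comment> \<open>On \<open>Y\<close> the metric has to be one that witnesses spherical
    completeness. Both spaces share the scale \<open>e\<close>, which depends only on the
    field.\<close>
  from assms(8)[unfolded spherically_complete_def]
  obtain d2 :: "'b \<Rightarrow> 'b \<Rightarrow> 'g" where d2: "compatible_metric Y d2 \<and> (\<forall>(s :: 'b set rel) x t.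
           Well_order s \<and> Field s \<noteq> {} \<and>
           (\<forall>i\<in>Field s. x i \<in> topspace Y \<and> 0 < t i) \<and>
           (\<forall>(i, j)\<in>s. closed_ball Y d2 (x j) (t j) \<subseteq> closed_ball Y d2 (x i) (t i)) \<longrightarrow>
           (\<Inter>i\<in>Field s. closed_ball Y d2 (x i) (t i)) \<noteq> {})" ..
  interpret MX: metric_scale r X d1 e using d1 e by unfold_locales
  interpret MY: metric_scale r Y d2 e using conjunct1[OF d2] e by unfold_locales
  have "weight_le Y r" using assms(7) unfolding metrizable_class_def by blast
  then interpret nested_pair r X "scale_equiv X d1 e" Y "scale_equiv Y d2 e"
    by unfold_locales (rule MY.weight_le_dense, assumption, rule MY.spherical_scale[OF conjunct2[OF d2]])
  show ?thesis using Baire_classes[OF assms(9)] by simp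
qed

end
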